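(* Let $G$ be an infinitely-ended group of uncountable cardinal $\alpha$. Then the cellularity of $\mathcal{E}^\star(G)$ is $\alpha$. In particular, $\mathcal{E}^\star(G)$ is not separable (and hence not metrizable).
   Context: A subset $A$ of a group $G$ is left $G$-commensurated if $gA\bigtriangleup A$ is finite for every $g\in G$. These subsets form a Boolean subalgebra $\mathcal{P}_{(G)}(G)$ of the power set of $G$; $\mathcal{P}^\star_G(G)$ denotes its quotient by the ideal of finite subsets of $G$. The space of ends $\mathcal{E}^\star(G)$ is the Stone dual of $\mathcal{P}^\star_G(G)$, i.e. the compact Hausdorff totally disconnected space whose Boolean algebra of clopen subsets is $\mathcal{P}^\star_G(G)$. $G$ is infinitely-ended if $\mathcal{P}^\star_G(G)$ is infinite. The cellularity of a topological space is the supremum of the cardinals of families of pairwise disjoint nonempty open subsets. *)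

theory Defs
  imports "HOL-Analysis.Analysis" "HOL-Algebra.Coset" "HOL-Algebra.Lattice"
begin

unbundle cardinal_syntax

section \<open>Commensurated subsets modulo finite subsets\<close>

definition commensurated :: "('a, 'b) monoid_scheme \<Rightarrow> 'a set set" where
  "commensurated G =
     {A. A \<subseteq> carrier G \<and> (\<forall>g\<in>carrier G. finite (sym_diff (g <#\<^bsub>G\<^esub> A) A))}"

definition almost_equal :: "('a, 'b) monoid_scheme \<Rightarrow> ('a set \<times> 'a set) set" where
  "almost_equal G =
     {(A, B). A \<in> commensurated G \<and> B \<in> commensurated G \<and> finite (sym_diff A B)}"

text \<open>The Boolean algebra of commensurated subsets modulo finite subsets is presented through its
  order: a class lies below another one iff it has a representative included in a representative of
  the other. The lemmas below identify the Boolean operations with those induced by the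
  set-theoretic ones.\<close>

definition ends_algebra :: "('a, 'b) monoid_scheme \<Rightarrow> 'a set set gorder" where
  "ends_algebra G =
     \<lparr> carrier = commensurated G // almost_equal G,
       eq = (=),
       le = (\<lambda>X Y. \<exists>A\<in>X. \<exists>B\<in>Y. A \<subseteq> B) \<rparr>"

definition infinitely_ended :: "('a, 'b) monoid_scheme \<Rightarrow> bool" where
  "infinitely_ended G \<longleftrightarrow> infinite (carrier (ends_algebra G))"

section \<open>Stone duals\<close>

text \<open>The following definitions are meant for (the order of) a Boolean algebra.\<close>

definition lattice_filter :: "('a, 'b) gorder_scheme \<Rightarrow> 'a set \<Rightarrow> bool" where
  "lattice_filter L F \<longleftrightarrow>
     F \<subseteq> carrier L \<and> F \<noteq> {} \<and>
     (\<forall>x\<in>F. \<forall>y\<in>F. x \<sqinter>\<^bsub>L\<^esub> y \<in> F) \<and>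
     (\<forall>x\<in>F. \<forall>y\<in>carrier L. x \<sqsubseteq>\<^bsub>L\<^esub> y \<longrightarrow> y \<in> F)"

definition lattice_ultrafilter :: "('a, 'b) gorder_scheme \<Rightarrow> 'a set \<Rightarrow> bool" where
  "lattice_ultrafilter L U \<longleftrightarrow>
     lattice_filter L U \<and> U \<noteq> carrier L \<and>
     (\<forall>F. lattice_filter L F \<and> F \<noteq> carrier L \<and> U \<subseteq> F \<longrightarrow> F = U)"

definition stone_dual :: "('a, 'b) gorder_scheme \<Rightarrow> 'a set topology" where
  "stone_dual L =
     topology_generated_by ((\<lambda>x. {U. lattice_ultrafilter L U \<and> x \<in> U}) ` carrier L)"

definition ends_space :: "('a, 'b) monoid_scheme \<Rightarrow> 'a set set set topology" where
  "ends_space G = stone_dual (ends_algebra G)"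

section \<open>Cellularity\<close>

definition cellular_family :: "'a topology \<Rightarrow> 'a set set \<Rightarrow> bool" where
  "cellular_family X \<F> \<longleftrightarrow> (\<forall>U\<in>\<F>. openin X U \<and> U \<noteq> {}) \<and> pairwise disjnt \<F>"

text \<open>Cardinals are represented, up to order isomorphism, by cardinal orders; \<open>\<kappa>\<close> is the cellularity if it is
  the least upper bound of the cardinals of cellular families. Comparing \<open>\<kappa>\<close> only with upper bounds
  on the same type loses nothing, see lemma \<open>has_cellularity_least\<close>.\<close>

definition has_cellularity :: "'a topology \<Rightarrow> 'c rel \<Rightarrow> bool" where
  "has_cellularity X \<kappa> \<longleftrightarrow>
     Card_order \<kappa> \<and>
     (\<forall>\<F>. cellular_family X \<F> \<longrightarrow> |\<F>| \<le>o \<kappa>) \<and>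
     (\<forall>\<kappa>' :: 'c rel. Card_order \<kappa>' \<and> (\<forall>\<F>. cellular_family X \<F> \<longrightarrow> |\<F>| \<le>o \<kappa>') \<longrightarrow> \<kappa> \<le>o \<kappa>')"

lemma has_cellularity_least:
  fixes \<kappa> :: "'c rel" and \<mu> :: "'d rel"
  assumes \<kappa>: "has_cellularity X \<kappa>" and \<mu>: "Card_order \<mu>"
    and ub: "\<And>\<F>. cellular_family X \<F> \<Longrightarrow> |\<F>| \<le>o \<mu>"
  shows "\<kappa> \<le>o \<mu>"
proof (rule ccontr)
  have C: "Card_order \<kappa>" using \<kappa> by (simp add: has_cellularity_def)
  assume n: "\<not> \<kappa> \<le>o \<mu>"
  have W: "Well_order \<kappa>" "Well_order \<mu>" using C \<mu> by (auto simp: card_order_on_def)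
  have "\<mu> <o \<kappa>" using n W by (simp add: not_ordLeq_iff_ordLess)
  then have "\<mu> \<le>o \<kappa>" by (rule ordLess_imp_ordLeq)
  then have "|Field \<mu>| \<le>o |Field \<kappa>|"
    by (rule card_of_mono2)
  then obtain f where f: "inj_on f (Field \<mu>)" "f ` Field \<mu> \<subseteq> Field \<kappa>"
    unfolding card_of_ordLeq[symmetric] by blast
  have "( |Field \<mu>|, |f ` Field \<mu>| ) \<in> ordIso"
    using f(1) by (rule card_of_ordIsoI[OF inj_on_imp_bij_betw])
  then have eq: "(\<mu>, |f ` Field \<mu>| ) \<in> ordIso"
    by (rule ordIso_transitive[OF ordIso_symmetric[OF card_of_Field_ordIso[OF \<mu>]]])
  have "|\<F>| \<le>o |f ` Field \<mu>|" if "cellular_family X \<F>" for \<F>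
    by (rule ordLeq_ordIso_trans[OF ub[OF that] eq])
  then have "\<kappa> \<le>o |f ` Field \<mu>|"
    using \<kappa>[unfolded has_cellularity_def, THEN conjunct2, THEN conjunct2, rule_format,
        of "|f ` Field \<mu>|"] card_of_Card_order[of "f ` Field \<mu>"] by simp
  then have "\<kappa> \<le>o \<mu>"
    by (rule ordLeq_ordIso_trans[OF _ ordIso_symmetric[OF eq]])
  with n show False by contradiction
qed

lemma has_cellularity_unique:
  assumes "has_cellularity X \<kappa>" "has_cellularity X \<mu>"
  shows "(\<kappa>, \<mu>) \<in> ordIso"
proof -
  have C: "Card_order \<kappa>" "Card_order \<mu>"
    using assms by (simp_all only: has_cellularity_def)
  have "|\<F>| \<le>o \<kappa>" "|\<F>| \<le>o \<mu>" if "cellular_family X \<F>" for \<F>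
    using assms that by (simp_all only: has_cellularity_def)
  then have "\<kappa> \<le>o \<mu> \<and> \<mu> \<le>o \<kappa>"
    by (simp add: has_cellularity_least[OF assms(1) C(2)] has_cellularity_least[OF assms(2) C(1)])
  then show ?thesis by (simp only: ordIso_iff_ordLeq)
qed

section \<open>Sanity checks on the algebra\<close>

context group
begin

lemma l_coset_Un: "g <#\<^bsub>G\<^esub> (A \<union> B) = (g <#\<^bsub>G\<^esub> A) \<union> (g <#\<^bsub>G\<^esub> B)"
  by (auto simp: l_coset_def)

lemma l_coset_Diff:
  assumes g: "g \<in> carrier G" and AB: "A \<subseteq> carrier G" "B \<subseteq> carrier G"
  shows "g <#\<^bsub>G\<^esub> (A - B) = (g <#\<^bsub>G\<^esub> A) - (g <#\<^bsub>G\<^esub> B)"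
proof -
  have "inj_on ((\<otimes>) g) (carrier G)"
    using g by (auto simp: inj_on_def)
  then have "(\<otimes>) g ` (A - B) = (\<otimes>) g ` A - (\<otimes>) g ` B"
    using AB by (intro inj_on_image_set_diff) auto
  then show ?thesis by (simp add: l_coset_def UNION_singleton_eq_range)
qed

lemma l_coset_carrier:
  assumes g: "g \<in> carrier G"
  shows "g <#\<^bsub>G\<^esub> carrier G = carrier G"
proof
  show "g <#\<^bsub>G\<^esub> carrier G \<subseteq> carrier G" using g by (auto simp: l_coset_def)
  show "carrier G \<subseteq> g <#\<^bsub>G\<^esub> carrier G"
  proof
    fix x assume x: "x \<in> carrier G"
    then have "x = g \<otimes> (inv g \<otimes> x)" using g by (simp add: m_assoc[symmetric])
    then show "x \<in> g <#\<^bsub>G\<^esub> carrier G"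
      using g x unfolding l_coset_def by blast
  qed
qed

lemma empty_commensurated: "{} \<in> commensurated G"
  by (auto simp: commensurated_def l_coset_def)

lemma finite_commensurated: "A \<subseteq> carrier G \<Longrightarrow> finite A \<Longrightarrow> A \<in> commensurated G"
  by (auto simp: commensurated_def l_coset_def)

lemma carrier_commensurated: "carrier G \<in> commensurated G"
  by (auto simp: commensurated_def l_coset_carrier)

lemma Un_commensurated:
  assumes "A \<in> commensurated G" "B \<in> commensurated G"
  shows "A \<union> B \<in> commensurated G"
proof -
  have "finite (sym_diff (g <#\<^bsub>G\<^esub> (A \<union> B)) (A \<union> B))" if "g \<in> carrier G" for g
  proof (rule finite_subset)
    show "sym_diff (g <#\<^bsub>G\<^esub> (A \<union> B)) (A \<union> B) \<subseteq> sym_diff (g <#\<^bsub>G\<^esub> A) A \<union> sym_diff (g <#\<^bsub>G\<^esub> B) B"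
      unfolding l_coset_Un by blast
    show "finite (sym_diff (g <#\<^bsub>G\<^esub> A) A \<union> sym_diff (g <#\<^bsub>G\<^esub> B) B)"
      using assms that by (auto simp: commensurated_def)
  qed
  then show ?thesis using assms by (auto simp: commensurated_def)
qed

lemma Diff_commensurated:
  assumes "A \<in> commensurated G" "B \<in> commensurated G"
  shows "A - B \<in> commensurated G"
proof -
  have AB: "A \<subseteq> carrier G" "B \<subseteq> carrier G" using assms by (auto simp: commensurated_def)
  have "finite (sym_diff (g <#\<^bsub>G\<^esub> (A - B)) (A - B))" if "g \<in> carrier G" for g
  proof (rule finite_subset)
    show "sym_diff (g <#\<^bsub>G\<^esub> (A - B)) (A - B) \<subseteq> sym_diff (g <#\<^bsub>G\<^esub> A) A \<union> sym_diff (g <#\<^bsub>G\<^esub> B) B"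
      unfolding l_coset_Diff[OF that AB] by blast
    show "finite (sym_diff (g <#\<^bsub>G\<^esub> A) A \<union> sym_diff (g <#\<^bsub>G\<^esub> B) B)"
      using assms that by (auto simp: commensurated_def)
  qed
  then show ?thesis using AB by (auto simp: commensurated_def)
qed

lemma Int_commensurated:
  assumes "A \<in> commensurated G" "B \<in> commensurated G"
  shows "A \<inter> B \<in> commensurated G"
proof -
  have "A \<inter> B = A - (A - B)" by blast
  then show ?thesis using Diff_commensurated[OF assms(1) Diff_commensurated[OF assms]] by simp
qed

lemma equiv_almost_equal: "equiv (commensurated G) (almost_equal G)"
proof (rule equivI)
  show "refl_on (commensurated G) (almost_equal G)"
    by (auto simp: refl_on_def almost_equal_def)
  show "sym (almost_equal G)"
    by (auto simp: sym_def almost_equal_def)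
  show "trans (almost_equal G)"
  proof (rule transI)
    fix A B C assume "(A, B) \<in> almost_equal G" "(B, C) \<in> almost_equal G"
    moreover have "sym_diff A C \<subseteq> sym_diff A B \<union> sym_diff B C" by blast
    ultimately show "(A, C) \<in> almost_equal G"
      unfolding almost_equal_def
      by (auto intro: finite_subset[of "A - C" "sym_diff A B \<union> sym_diff B C"]
            finite_subset[of "C - A" "sym_diff A B \<union> sym_diff B C"])
  qed
qed (auto simp: almost_equal_def)

abbreviation ends_class :: "'a set \<Rightarrow> 'a set set" where
  "ends_class A \<equiv> almost_equal G `` {A}"

lemma ends_class_in: "A \<in> commensurated G \<Longrightarrow> ends_class A \<in> carrier (ends_algebra G)"
  by (simp add: ends_algebra_def quotientI)

lemma ends_class_cases:
  assumes "X \<in> carrier (ends_algebra G)"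
  obtains A where "A \<in> commensurated G" "X = ends_class A"
  using assms by (auto simp: ends_algebra_def elim: quotientE)

lemma ends_class_eq_iff:
  assumes "A \<in> commensurated G" "B \<in> commensurated G"
  shows "ends_class A = ends_class B \<longleftrightarrow> finite (sym_diff A B)"
  using eq_equiv_class_iff[OF equiv_almost_equal assms] assms by (auto simp: almost_equal_def)

lemma ends_class_le_iff:
  assumes A: "A \<in> commensurated G" and B: "B \<in> commensurated G"
  shows "ends_class A \<sqsubseteq>\<^bsub>ends_algebra G\<^esub> ends_class B \<longleftrightarrow> finite (A - B)"
proof
  assume "ends_class A \<sqsubseteq>\<^bsub>ends_algebra G\<^esub> ends_class B"
  then obtain A' B' where "finite (sym_diff A A')" "finite (sym_diff B B')" "A' \<subseteq> B'"
    by (auto simp: ends_algebra_def almost_equal_def)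
  moreover have "A - B \<subseteq> sym_diff A A' \<union> sym_diff B B'" using \<open>A' \<subseteq> B'\<close> by blast
  ultimately show "finite (A - B)" by (meson finite_UnI finite_subset)
next
  assume fin: "finite (A - B)"
  have "finite (sym_diff A (A \<inter> B))"
    by (rule finite_subset[OF _ fin]) blast
  then have "A \<inter> B \<in> ends_class A"
    using A B Int_commensurated by (auto simp: almost_equal_def)
  moreover have "B \<in> ends_class B" using B by (auto simp: almost_equal_def)
  ultimately show "ends_class A \<sqsubseteq>\<^bsub>ends_algebra G\<^esub> ends_class B"
    unfolding ends_algebra_def by (simp del: Image_singleton_iff) blast
qed

lemma partial_order_ends_algebra: "partial_order (ends_algebra G)"
proof
  fix X assume "X \<in> carrier (ends_algebra G)"
  then obtain A where "A \<in> commensurated G" "X = ends_class A"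
    by (rule ends_class_cases)
  then show "X \<sqsubseteq>\<^bsub>ends_algebra G\<^esub> X"
    by (simp add: ends_class_le_iff)
next
  fix X Y assume *: "X \<sqsubseteq>\<^bsub>ends_algebra G\<^esub> Y" "Y \<sqsubseteq>\<^bsub>ends_algebra G\<^esub> X"
    "X \<in> carrier (ends_algebra G)" "Y \<in> carrier (ends_algebra G)"
  obtain A where A: "A \<in> commensurated G" "X = ends_class A"
    using *(3) by (rule ends_class_cases)
  obtain B where B: "B \<in> commensurated G" "Y = ends_class B"
    using *(4) by (rule ends_class_cases)
  have "X = Y" using * A B by (simp add: ends_class_le_iff ends_class_eq_iff)
  then show "X .=\<^bsub>ends_algebra G\<^esub> Y" by (simp add: ends_algebra_def)
next
  fix X Y Z assume *: "X \<sqsubseteq>\<^bsub>ends_algebra G\<^esub> Y" "Y \<sqsubseteq>\<^bsub>ends_algebra G\<^esub> Z"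
    "X \<in> carrier (ends_algebra G)" "Y \<in> carrier (ends_algebra G)" "Z \<in> carrier (ends_algebra G)"
  obtain A where A: "A \<in> commensurated G" "X = ends_class A"
    using *(3) by (rule ends_class_cases)
  obtain B where B: "B \<in> commensurated G" "Y = ends_class B"
    using *(4) by (rule ends_class_cases)
  obtain C where C: "C \<in> commensurated G" "Z = ends_class C"
    using *(5) by (rule ends_class_cases)
  note ABC = A B C
  have "finite (A - B)" "finite (B - C)" using * ABC by (simp_all add: ends_class_le_iff)
  moreover have "A - C \<subseteq> (A - B) \<union> (B - C)" by blast
  ultimately have "finite (A - C)" by (meson finite_UnI finite_subset)
  then show "X \<sqsubseteq>\<^bsub>ends_algebra G\<^esub> Z" using ABC by (simp add: ends_class_le_iff)
qed (auto simp: ends_algebra_def)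

lemma greatest_ends_class_Int:
  assumes A: "A \<in> commensurated G" and B: "B \<in> commensurated G"
  shows "greatest (ends_algebra G) (ends_class (A \<inter> B))
           (Lower (ends_algebra G) {ends_class A, ends_class B})"
proof -
  have AB: "A \<inter> B \<in> commensurated G" using A B by (rule Int_commensurated)
  have "ends_class (A \<inter> B) \<in> Lower (ends_algebra G) {ends_class A, ends_class B}"
    using A B AB by (auto simp: Lower_def ends_class_in ends_class_le_iff Int_Diff)
  moreover have "X \<sqsubseteq>\<^bsub>ends_algebra G\<^esub> ends_class (A \<inter> B)"
    if X: "X \<in> Lower (ends_algebra G) {ends_class A, ends_class B}" for X
  proof -
    have "X \<in> carrier (ends_algebra G)" using X by (simp add: Lower_def)
    then obtain C where C: "C \<in> commensurated G" "X = ends_class C"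
      by (rule ends_class_cases)
    have "finite (C - A)" "finite (C - B)"
      using X A B C by (auto simp: Lower_def ends_class_in ends_class_le_iff)
    then show ?thesis using C AB by (simp add: ends_class_le_iff Diff_Int)
  qed
  ultimately show ?thesis by (auto simp: greatest_def Lower_def)
qed

lemma least_ends_class_Un:
  assumes A: "A \<in> commensurated G" and B: "B \<in> commensurated G"
  shows "least (ends_algebra G) (ends_class (A \<union> B))
           (Upper (ends_algebra G) {ends_class A, ends_class B})"
proof -
  have AB: "A \<union> B \<in> commensurated G" using A B by (rule Un_commensurated)
  have d: "finite (A - (A \<union> B))" "finite (B - (A \<union> B))" by (simp_all add: Diff_eq_empty_iff[THEN iffD2])
  have "ends_class (A \<union> B) \<in> Upper (ends_algebra G) {ends_class A, ends_class B}"
    using A B AB d by (auto simp: Upper_def ends_class_in ends_class_le_iff)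
  moreover have "ends_class (A \<union> B) \<sqsubseteq>\<^bsub>ends_algebra G\<^esub> X"
    if X: "X \<in> Upper (ends_algebra G) {ends_class A, ends_class B}" for X
  proof -
    have "X \<in> carrier (ends_algebra G)" using X by (simp add: Upper_def)
    then obtain C where C: "C \<in> commensurated G" "X = ends_class C"
      by (rule ends_class_cases)
    have "finite (A - C)" "finite (B - C)"
      using X A B C by (auto simp: Upper_def ends_class_in ends_class_le_iff)
    then show ?thesis using C AB by (simp add: ends_class_le_iff Un_Diff)
  qed
  ultimately show ?thesis by (auto simp: least_def Upper_def)
qed

lemma bounded_lattice_ends_algebra: "bounded_lattice (ends_algebra G)"
proof -
  interpret partial_order "ends_algebra G" by (rule partial_order_ends_algebra)
  show ?thesis
  proof
    fix X Y assume *: "X \<in> carrier (ends_algebra G)" "Y \<in> carrier (ends_algebra G)"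
    obtain A where A: "A \<in> commensurated G" "X = ends_class A"
      using *(1) by (rule ends_class_cases)
    obtain B where B: "B \<in> commensurated G" "Y = ends_class B"
      using *(2) by (rule ends_class_cases)
    show "\<exists>s. least (ends_algebra G) s (Upper (ends_algebra G) {X, Y})"
      unfolding A(2) B(2) by (rule exI, rule least_ends_class_Un[OF A(1) B(1)])
    show "\<exists>s. greatest (ends_algebra G) s (Lower (ends_algebra G) {X, Y})"
      unfolding A(2) B(2) by (rule exI, rule greatest_ends_class_Int[OF A(1) B(1)])
  next
    have "ends_class {} \<sqsubseteq>\<^bsub>ends_algebra G\<^esub> X"
      if X: "X \<in> carrier (ends_algebra G)" for X
    proof -
      from X obtain A where "A \<in> commensurated G" "X = ends_class A"
        by (rule ends_class_cases)
      then show ?thesis using empty_commensurated by (simp add: ends_class_le_iff)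
    qed
    then have "least (ends_algebra G) (ends_class {}) (carrier (ends_algebra G))"
      using empty_commensurated by (simp add: least_def ends_class_in)
    then show "\<exists>b. least (ends_algebra G) b (carrier (ends_algebra G))" by (rule exI)
  next
    have "greatest (ends_algebra G) (ends_class (carrier G)) (carrier (ends_algebra G))"
    proof -
      have "X \<sqsubseteq>\<^bsub>ends_algebra G\<^esub> ends_class (carrier G)"
        if X: "X \<in> carrier (ends_algebra G)" for X
      proof -
        from X obtain A where A: "A \<in> commensurated G" "X = ends_class A"
          by (rule ends_class_cases)
        then have "finite (A - carrier G)"
          by (simp add: commensurated_def Diff_eq_empty_iff[THEN iffD2])
        then show ?thesis using A carrier_commensurated by (simp add: ends_class_le_iff)
      qed
      then show ?thesis using carrier_commensurated by (simp add: greatest_def ends_class_in)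
    qed
    then show "\<exists>t. greatest (ends_algebra G) t (carrier (ends_algebra G))" by (rule exI)
  qed
qed

lemma meet_ends_class:
  assumes "A \<in> commensurated G" "B \<in> commensurated G"
  shows "ends_class A \<sqinter>\<^bsub>ends_algebra G\<^esub> ends_class B = ends_class (A \<inter> B)"
proof -
  note greatest = greatest_ends_class_Int[OF assms]
  have "S = ends_class (A \<inter> B)"
    if "greatest (ends_algebra G) S (Lower (ends_algebra G) {ends_class A, ends_class B})" for S
    using that greatest by (rule partial_order.greatest_unique[OF partial_order_ends_algebra])
  then have "(SOME S. greatest (ends_algebra G) S (Lower (ends_algebra G) {ends_class A, ends_class B}))
      = ends_class (A \<inter> B)"
    using someI[of "\<lambda>S. greatest (ends_algebra G) S (Lower (ends_algebra G) {ends_class A, ends_class B})",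
        OF greatest] by (simp only:)
  then show ?thesis by (simp only: meet_def Lattice.inf_def)
qed

lemma join_ends_class:
  assumes "A \<in> commensurated G" "B \<in> commensurated G"
  shows "ends_class A \<squnion>\<^bsub>ends_algebra G\<^esub> ends_class B = ends_class (A \<union> B)"
proof -
  note least = least_ends_class_Un[OF assms]
  have "S = ends_class (A \<union> B)"
    if "least (ends_algebra G) S (Upper (ends_algebra G) {ends_class A, ends_class B})" for S
    using that least by (rule partial_order.least_unique[OF partial_order_ends_algebra])
  then have "(SOME S. least (ends_algebra G) S (Upper (ends_algebra G) {ends_class A, ends_class B}))
      = ends_class (A \<union> B)"
    using someI[of "\<lambda>S. least (ends_algebra G) S (Upper (ends_algebra G) {ends_class A, ends_class B})",
        OF least] by (simp only:)
  then show ?thesis by (simp only: join_def Lattice.sup_def)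
qed

lemma topspace_ends_space:
  "topspace (ends_space G) = {U. lattice_ultrafilter (ends_algebra G) U}"
proof -
  have "U \<noteq> {}" "U \<subseteq> carrier (ends_algebra G)" if "lattice_ultrafilter (ends_algebra G) U" for U
    using that by (simp_all add: lattice_ultrafilter_def lattice_filter_def)
  then have "\<exists>x\<in>carrier (ends_algebra G). x \<in> U" if "lattice_ultrafilter (ends_algebra G) U" for U
    using that by (meson ex_in_conv subsetD)
  then have "(\<Union>x\<in>carrier (ends_algebra G). {U. lattice_ultrafilter (ends_algebra G) U \<and> x \<in> U})
      = {U. lattice_ultrafilter (ends_algebra G) U}"
    by blast
  then show ?thesis
    by (simp only: ends_space_def stone_dual_def topology_generated_by_topspace)
qed

end

end

theory Submission
  imports Defs "HOL-Algebra.Free_Abelian_Groups"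
begin

text \<open>
  Write \<open>\<alpha>\<close> for the cardinal of \<open>G\<close>. Through Stone duality, a cellular family of the space of ends can
  be replaced by a family of infinite commensurated subsets of \<open>G\<close> with pairwise finite intersections
  (\<open>stone_set_base\<close>, \<open>stone_set_Int\<close>, \<open>stone_set_nonempty_iff\<close>).

  \<^emph>\<open>Upper bound\<close> (\<open>almost_disjoint_family_ordLeq\<close>). Fix a countable infinite \<open>S \<subseteq> G\<close>. An infinite commensurated
  set \<open>A\<close> is uncountable, while for every \<open>s\<close> only finitely many \<open>x \<in> A\<close> satisfy \<open>s x \<notin> A\<close>; so \<open>A\<close> contains
  a translate \<open>S x\<close>. Almost disjoint sets cannot contain the same translate, hence
  \<open>A \<mapsto> x\<close> is injective on an almost disjoint family.

  \<^emph>\<open>Lower bound\<close> (\<open>large_disjoint_family\<close>). Let \<open>A\<close> be commensurated, infinite and co-infinite. Every translate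
  \<open>g A\<close> differs from \<open>A\<close> by a finite set, so \<open>G\<close> acts on the sets almost equal to \<open>A\<close>. A closure argument
  yields a set \<open>B\<close> almost equal to \<open>A\<close> that is approached by the orbit of \<open>A\<close>: for every small \<open>K \<subseteq> G\<close>
  some \<open>g \<notin> K\<close> makes \<open>g A\<close> agree with \<open>B\<close> on \<open>K\<close> (\<open>recurrent_modification\<close>); here small means of cardinal
  at most a fixed infinite \<open>|Z|\<close> below \<open>\<alpha>\<close>. For a subgroup \<open>H\<close> closed
  under \<open>h \<mapsto> h B \<triangle> B\<close> and a point \<open>x\<close>, consider the branch
  \<open>{g. g\<inverse> A \<inter> H = B \<inter> H \<and> x \<in> g\<inverse> A \<triangle> B}\<close>. Although \<open>H\<close> may be infinite, the branch is commensurated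
  (\<open>branch_commensurated\<close>): an element of \<open>H\<close> that fixes the trace \<open>B \<inter> H\<close> fixes \<open>B\<close>, and since \<open>G\<close>
  acts freely on itself only finitely many of these elements can keep \<open>x\<close> inside a given finite symmetric
  difference with \<open>B\<close>. The branches of \<open>(H, x)\<close> and \<open>(K, y)\<close> are disjoint as soon as \<open>H \<union> {x} \<subseteq> K\<close>.
  Hence a disjoint family of at most \<open>|Z|\<close> infinite branches with small \<open>H\<close> is never maximal: let \<open>K\<close> be a
  small closed subgroup containing all its parameters and infinitely many elements of \<open>A\<close> and of \<open>G - A\<close>,
  and take \<open>g \<notin> K\<close> with \<open>g A \<inter> K = B \<inter> K\<close>; the branch of \<open>(K, g)\<close> is infinite (\<open>infinite_branch\<close>) and can
  be added. So for every infinite cardinal below \<open>\<alpha>\<close> there is a larger cellular family.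

  In particular there is an uncountable cellular family, which a separable space excludes; and a compact
  metrizable space is separable.
\<close>

text \<open>The multiset inclusion would make left cosets ambiguous.\<close>

no_notation (ASCII) subset_mset  (infix \<open><#\<close> 50)

section \<open>Closing a set under finitary operations\<close>

lemma card_Fpow_ordLeq:
  assumes "infinite Z" "|K| \<le>o |Z|"
  shows "|Fpow K| \<le>o |Z|"
proof -
  obtain f where f: "inj_on f K" "f ` K \<subseteq> Z"
    using assms(2) card_of_ordLeq[of K Z] by blast
  have "inj_on ((`) f) (Fpow K)" using f(1) by (rule inj_on_image_Fpow)
  moreover have "(`) f ` Fpow K \<subseteq> Fpow Z" using f(2) by (auto simp: Fpow_def)
  ultimately have "|Fpow K| \<le>o |Fpow Z|" by (metis card_of_ordLeq)
  then show ?thesis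
    using card_of_Fpow_infinite[OF assms(1)] by (rule ordLeq_ordIso_trans)
qed

lemma countable_ordLeq_infinite:
  assumes "countable S" "infinite Z"
  shows "|S| \<le>o |Z|"
proof -
  obtain f :: "'a \<Rightarrow> nat" where "inj_on f S" using assms(1) by (rule countableE)
  then have "|S| \<le>o |UNIV :: nat set|" by (meson card_of_ordLeq subset_UNIV)
  moreover have "|UNIV :: nat set| \<le>o |Z|" using assms(2) by (simp add: infinite_iff_card_of_nat)
  ultimately show ?thesis by (rule ordLeq_transitive)
qed

text \<open>Iterating the operation \<open>\<omega>\<close> times suffices because it only looks at finite subsets; each
  iteration preserves the bound since an infinite set has as many finite subsets as elements.\<close>

lemma finitary_hull:
  assumes Z: "infinite Z" and X: "|X| \<le>o |Z|" "X \<subseteq> C"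
    and \<Phi>: "\<And>F. finite F \<Longrightarrow> F \<subseteq> C \<Longrightarrow> \<Phi> F \<subseteq> C"
    and card: "\<And>F. finite F \<Longrightarrow> F \<subseteq> C \<Longrightarrow> |\<Phi> F| \<le>o |Z|"
  shows "\<exists>K. X \<subseteq> K \<and> K \<subseteq> C \<and> |K| \<le>o |Z| \<and>
    (\<forall>F. finite F \<longrightarrow> F \<subseteq> K \<longrightarrow> \<Phi> F \<subseteq> K)"
proof -
  define step where "step K = K \<union> (\<Union>F\<in>Fpow K. \<Phi> F)" for K
  define S where "S n = (step ^^ n) X" for n
  have S_Suc: "S (Suc n) = step (S n)" for n by (simp add: S_def)
  have S: "S n \<subseteq> C \<and> |S n| \<le>o |Z|" for n
  proof (induction n)
    case 0 then show ?case using X by (simp add: S_def)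
  next
    case (Suc n)
    have "|\<Union>F\<in>Fpow (S n). \<Phi> F| \<le>o |Z|"
    proof (rule card_of_UNION_ordLeq_infinite[OF Z])
      show "|Fpow (S n)| \<le>o |Z|" using card_Fpow_ordLeq[OF Z] Suc by blast
      show "\<forall>F\<in>Fpow (S n). |\<Phi> F| \<le>o |Z|" using card Suc by (auto simp: Fpow_def)
    qed
    then have "|step (S n)| \<le>o |Z|"
      unfolding step_def using Suc Z
      by (intro card_of_Un_ordLeq_infinite_Field) (auto simp: card_of_Card_order)
    moreover have "step (S n) \<subseteq> C"
      unfolding step_def using Suc \<Phi> by (auto simp: Fpow_def subset_iff)
    ultimately show ?case by (simp add: S_Suc)
  qed
  have mono: "mono S" by (rule incseq_SucI) (auto simp: S_Suc step_def)
  define K where "K = (\<Union>n. S n)"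
  show ?thesis
  proof (intro exI conjI allI impI)
    show "X \<subseteq> K" unfolding K_def using UN_upper[of 0 UNIV S] by (simp add: S_def)
    show "K \<subseteq> C" using S by (auto simp: K_def)
    have "|UNIV :: nat set| \<le>o |Z|" using Z by (simp add: infinite_iff_card_of_nat)
    then show "|K| \<le>o |Z|" unfolding K_def
      using S by (intro card_of_UNION_ordLeq_infinite[OF Z]) auto
    fix F assume F: "finite F" "F \<subseteq> K"
    have "\<exists>n. F \<subseteq> S n"
      using F
    proof (induction F)
      case (insert y F)
      then obtain n m where "F \<subseteq> S n" "y \<in> S m" by (auto simp: K_def)
      then have "insert y F \<subseteq> S (max n m)"
        using monoD[OF mono, of n "max n m"] monoD[OF mono, of m "max n m"] by auto
      then show ?case ..
    qed auto
    then obtain n where "F \<in> Fpow (S n)" using F(1) by (auto simp: Fpow_def)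
    then have "\<Phi> F \<subseteq> S (Suc n)" by (auto simp: S_Suc step_def)
    then show "\<Phi> F \<subseteq> K" by (auto simp: K_def)
  qed
qed

context group
begin

section \<open>Translates of commensurated sets\<close>

lemma mem_l_coset_iff:
  assumes "g \<in> carrier G" "x \<in> carrier G" "A \<subseteq> carrier G"
  shows "x \<in> g <# A \<longleftrightarrow> inv g \<otimes> x \<in> A"
proof
  assume "x \<in> g <# A"
  then obtain a where "a \<in> A" "x = g \<otimes> a" by (auto simp: l_coset_def)
  then show "inv g \<otimes> x \<in> A" using assms by (auto simp: m_assoc[symmetric])
next
  assume "inv g \<otimes> x \<in> A"
  moreover have "x = g \<otimes> (inv g \<otimes> x)" using assms by (simp add: m_assoc[symmetric])
  ultimately show "x \<in> g <# A" unfolding l_coset_def by blast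
qed

lemma commensuratedD:
  assumes "A \<in> commensurated G"
  shows "A \<subseteq> carrier G" "g \<in> carrier G \<Longrightarrow> finite (sym_diff (g <# A) A)"
  using assms by (auto simp: commensurated_def)

lemma commensurated_cong:
  assumes A: "A \<in> commensurated G" and B: "B \<subseteq> carrier G" "finite (sym_diff A B)"
  shows "B \<in> commensurated G"
proof -
  have "A - B \<in> commensurated G" "B - A \<in> commensurated G"
    using A B by (auto intro!: finite_commensurated dest: commensuratedD)
  then have "(A - (A - B)) \<union> (B - A) \<in> commensurated G"
    using A by (blast intro: Un_commensurated Diff_commensurated)
  moreover have "(A - (A - B)) \<union> (B - A) = B" by blast
  ultimately show ?thesis by simp
qed

text \<open>The point of the second condition is that an element of \<open>H\<close> which preserves the trace of \<open>A\<close> on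
  \<open>H\<close> stabilises \<open>A\<close> itself.\<close>

definition absorbs :: "'a set \<Rightarrow> 'a set \<Rightarrow> bool" where
  "absorbs H A \<longleftrightarrow> subgroup H G \<and> (\<forall>h\<in>H. sym_diff (h <# A) A \<subseteq> H)"

lemma absorbing_hull:
  assumes A: "A \<in> commensurated G" and B: "B \<in> commensurated G"
    and Z: "infinite Z" and X: "|X| \<le>o |Z|" "X \<subseteq> carrier G"
  obtains K where "X \<subseteq> K" "|K| \<le>o |Z|" "absorbs K A" "absorbs K B"
proof -
  define \<Phi> where "\<Phi> F = {\<one>} \<union> (\<Union>a\<in>F. \<Union>b\<in>F. {a \<otimes> b}) \<union> (\<lambda>a. inv a) ` F
      \<union> (\<Union>a\<in>F. sym_diff (a <# A) A \<union> sym_diff (a <# B) B)" for F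
  have sub: "A \<subseteq> carrier G" "B \<subseteq> carrier G" using A B by (auto dest: commensuratedD)
  have fin: "finite (\<Phi> F)" if "finite F" "F \<subseteq> carrier G" for F
    using that commensuratedD(2)[OF A] commensuratedD(2)[OF B] by (auto simp: \<Phi>_def)
  have \<Phi>: "\<Phi> F \<subseteq> carrier G" if "finite F" "F \<subseteq> carrier G" for F
    using that sub by (auto simp: \<Phi>_def l_coset_def)
  have "|\<Phi> F| \<le>o |Z|" if "finite F" "F \<subseteq> carrier G" for F
    using fin[OF that] Z by (simp add: ordLess_imp_ordLeq finite_ordLess_infinite2)
  then obtain K where K: "X \<subseteq> K" "K \<subseteq> carrier G" "|K| \<le>o |Z|"
    "\<And>F. finite F \<Longrightarrow> F \<subseteq> K \<Longrightarrow> \<Phi> F \<subseteq> K"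
    using finitary_hull[OF Z X, of \<Phi>] \<Phi> by blast
  have 2: "\<Phi> {a, b} \<subseteq> K" if "a \<in> K" "b \<in> K" for a b using K(4) that by simp
  have "subgroup K G"
  proof
    show "K \<subseteq> carrier G" by (rule K)
    show "a \<otimes> b \<in> K" if "a \<in> K" "b \<in> K" for a b using 2[OF that] by (auto simp: \<Phi>_def)
    show "\<one> \<in> K" using K(4)[of "{}"] by (auto simp: \<Phi>_def)
    show "inv a \<in> K" if "a \<in> K" for a using 2[OF that that] by (auto simp: \<Phi>_def)
  qed
  then have "absorbs K A" "absorbs K B"
    using 2 by (auto simp: \<Phi>_def absorbs_def)
  with K(1,3) show ?thesis by (rule that)
qed

section \<open>Large families of disjoint commensurated sets\<close>

text \<open>Otherwise each finite \<open>E\<close> has a small witness \<open>k E\<close> against \<open>A \<triangle> E\<close>. Close up under \<open>k\<close> to a small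
  \<open>H\<close> and take any \<open>g\<close> outside \<open>H\<close>: the part of \<open>g A \<triangle> A\<close> inside \<open>H\<close> is a finite \<open>E \<subseteq> H\<close>
  whose witness is refuted by \<open>g\<close>.\<close>

lemma recurrent_modification:
  assumes A: "A \<in> commensurated G" and Z: "infinite Z" "|Z| <o |carrier G|"
  obtains B where "B \<in> commensurated G" "finite (sym_diff A B)"
    "\<And>K. |K| \<le>o |Z| \<Longrightarrow> \<exists>g\<in>carrier G - K. (g <# A) \<inter> K = B \<inter> K"
proof -
  have sub: "A \<subseteq> carrier G" using A by (rule commensuratedD)
  define R where "R E K \<longleftrightarrow> (\<exists>g\<in>carrier G - K. (g <# A) \<inter> K = sym_diff A E \<inter> K)" for E K
  have "\<exists>E. finite E \<and> E \<subseteq> carrier G \<and> (\<forall>K. |K| \<le>o |Z| \<longrightarrow> R E K)"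
  proof (rule ccontr)
    assume neg: "\<not> ?thesis"
    define k where "k E = (SOME K. |K| \<le>o |Z| \<and> \<not> R E K)" for E
    have k: "|k E| \<le>o |Z| \<and> \<not> R E (k E)" if "finite E" "E \<subseteq> carrier G" for E
      unfolding k_def by (rule someI_ex) (use neg that in blast)
    have "|k F \<inter> carrier G| \<le>o |Z|" if "finite F" "F \<subseteq> carrier G" for F
      by (rule ordLeq_transitive[OF card_of_mono1 k[OF that, THEN conjunct1]]) simp
    then have "\<exists>H. {} \<subseteq> H \<and> H \<subseteq> carrier G \<and> |H| \<le>o |Z| \<and>
        (\<forall>E. finite E \<longrightarrow> E \<subseteq> H \<longrightarrow> k E \<inter> carrier G \<subseteq> H)"
      by (intro finitary_hull[OF Z(1)]) (simp_all add: card_of_empty)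
    then obtain H where H: "H \<subseteq> carrier G" "|H| \<le>o |Z|"
      "\<And>E. finite E \<Longrightarrow> E \<subseteq> H \<Longrightarrow> k E \<inter> carrier G \<subseteq> H"
      by blast
    have "\<not> |carrier G| \<le>o |H|"
      using Z(2) H(2) by (meson not_ordLess_ordLeq ordLeq_transitive)
    then obtain g where g: "g \<in> carrier G" "g \<notin> H"
      using card_of_mono1[of "carrier G" H] by blast
    define E where "E = sym_diff (g <# A) A \<inter> H"
    have E: "finite E" "E \<subseteq> H" "E \<subseteq> carrier G"
      using commensuratedD(2)[OF A g(1)] H(1) by (auto simp: E_def)
    have kE: "k E \<inter> carrier G \<subseteq> H" using H(3) E by blast
    have "g <# A \<subseteq> carrier G" using g sub by (auto simp: l_coset_def)
    then have "(g <# A) \<inter> k E = sym_diff A E \<inter> k E"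
      using kE sub E(3) unfolding E_def by blast
    moreover have "g \<in> carrier G - k E" using g kE by blast
    ultimately have "R E (k E)" unfolding R_def by (rule bexI)
    then show False using k[OF E(1,3)] by simp
  qed
  then obtain E where E: "finite E" "E \<subseteq> carrier G" "\<And>K. |K| \<le>o |Z| \<Longrightarrow> R E K"
    by blast
  have fin: "finite (sym_diff A (sym_diff A E))"
    by (rule finite_subset[OF _ E(1)]) blast
  have "sym_diff A E \<in> commensurated G"
    by (rule commensurated_cong[OF A _ fin]) (use sub E(2) in blast)
  from this fin E(3)[unfolded R_def] show ?thesis by (rule that)
qed

text \<open>Picture \<open>g \<mapsto> g\<inverse> A\<close> as a map from \<open>G\<close> to the sets almost equal to \<open>B\<close>. The branch collects
  the elements whose image is not distinguished from \<open>B\<close> inside \<open>H\<close> but leaves \<open>B\<close> at \<open>x\<close>.\<close>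

definition branch :: "'a set \<Rightarrow> 'a set \<Rightarrow> 'a set \<Rightarrow> 'a \<Rightarrow> 'a set" where
  "branch A B H x =
     {g \<in> carrier G. (inv g <# A) \<inter> H = B \<inter> H \<and> x \<in> sym_diff (inv g <# A) B}"

text \<open>Two solutions \<open>p\<close> and \<open>p0\<close> differ by an element \<open>s = p p0\<inverse>\<close> of \<open>H\<close> that preserves \<open>B \<inter> H\<close>, hence
  stabilises \<open>B\<close>. Then \<open>s\<inverse> x\<close> lies in the finite set \<open>p0 V \<triangle> B\<close>, which leaves finitely many
  choices for \<open>s\<close> even when the stabiliser of \<open>B\<close> is infinite.\<close>

lemma finite_branch_slice:
  assumes H: "absorbs H B" and B: "B \<subseteq> carrier G" and V: "V \<subseteq> carrier G"
    and z: "z \<in> carrier G" and x: "x \<in> carrier G"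
    and fin: "\<And>p. p \<in> carrier G \<Longrightarrow> finite (sym_diff (p <# V) B)"
  shows "finite {p \<in> carrier G. p \<otimes> z \<in> H \<and> (p <# V) \<inter> H = B \<inter> H \<and> x \<in> sym_diff (p <# V) B}"
    (is "finite ?P")
proof (cases "?P = {}")
  case True then show ?thesis by (simp only: finite.emptyI)
next
  case False
  then obtain p0 where p0: "p0 \<in> ?P" by blast
  interpret H: subgroup H G using H by (simp add: absorbs_def)
  have "?P \<subseteq> (\<lambda>q. x \<otimes> inv q \<otimes> p0) ` sym_diff (p0 <# V) B"
  proof
    fix p assume p: "p \<in> ?P"
    define s where "s = p \<otimes> inv p0"
    have c: "p \<in> carrier G" "p0 \<in> carrier G" using p p0 by auto
    have s_c: "s \<in> carrier G" using c by (simp add: s_def)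
    have "(p \<otimes> z) \<otimes> inv (p0 \<otimes> z) = s"
      using c z by (simp add: s_def inv_mult_group m_assoc inv_solve_left m_assoc[symmetric, of z])
    moreover have "p \<otimes> z \<in> H" "p0 \<otimes> z \<in> H" using p p0 by blast+
    ultimately have s: "s \<in> H" using H.m_closed H.m_inv_closed by metis
    have ps: "p = s \<otimes> p0" using c by (simp add: s_def m_assoc)
    have V': "p0 <# V \<subseteq> carrier G" using c V by (auto simp: l_coset_def)
    have pV: "p <# V = s <# (p0 <# V)" using c V s_c by (simp add: ps lcos_m_assoc)
    \<comment> \<open>\<open>s\<close> preserves \<open>B \<inter> H\<close> because both \<open>p V\<close> and \<open>p0 V\<close> have this trace on \<open>H\<close>\<close>
    have "(s <# B) \<inter> H = B \<inter> H"
    proof -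
      have "y \<in> s <# B \<longleftrightarrow> y \<in> B" if y: "y \<in> H" for y
      proof -
        have sy: "inv s \<otimes> y \<in> H" using s y by simp
        have "y \<in> s <# B \<longleftrightarrow> inv s \<otimes> y \<in> B" using s_c y B by (simp add: mem_l_coset_iff)
        also have "\<dots> \<longleftrightarrow> inv s \<otimes> y \<in> p0 <# V" using p0 sy by blast
        also have "\<dots> \<longleftrightarrow> y \<in> p <# V" using s_c y V' by (simp add: pV mem_l_coset_iff)
        also have "\<dots> \<longleftrightarrow> y \<in> B" using p y by blast
        finally show ?thesis .
      qed
      then show ?thesis by blast
    qed
    moreover have "sym_diff (s <# B) B \<subseteq> H" using H s by (simp add: absorbs_def)
    ultimately have sB: "s <# B = B" by blast
    define q where "q = inv s \<otimes> x"
    have q_c: "q \<in> carrier G" using s_c x by (simp add: q_def)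
    have "x \<in> sym_diff (s <# (p0 <# V)) (s <# B)" using p by (simp add: pV sB)
    then have "q \<in> sym_diff (p0 <# V) B"
      using s_c x V' B by (auto simp: q_def mem_l_coset_iff)
    moreover have "p = x \<otimes> inv q \<otimes> p0"
      using s_c x c by (simp add: q_def inv_mult_group m_assoc[symmetric] ps)
    ultimately show "p \<in> (\<lambda>q. x \<otimes> inv q \<otimes> p0) ` sym_diff (p0 <# V) B" by blast
  qed
  then show ?thesis using fin[of p0] p0 by (auto intro: finite_subset)
qed

text \<open>Replacing \<open>g\<close> by \<open>a\<inverse> g\<close> changes \<open>p A\<close>, for \<open>p = g\<inverse>\<close>, exactly on the finite set \<open>p F\<close> with
  \<open>F = a A \<triangle> A\<close>. Membership in the branch can be affected only if \<open>p F\<close> meets \<open>H\<close> or contains \<open>x\<close>;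
  the second case fixes \<open>p\<close> up to finitely many choices, and the first one is a slice as above.\<close>

lemma branch_commensurated:
  assumes A: "A \<in> commensurated G" and B: "B \<in> commensurated G" and AB: "finite (sym_diff A B)"
    and H: "absorbs H B" and x: "x \<in> carrier G"
  shows "branch A B H x \<in> commensurated G"
proof -
  have sub: "A \<subseteq> carrier G" "B \<subseteq> carrier G" using A B by (auto dest: commensuratedD)
  interpret H: subgroup H G using H by (simp add: absorbs_def)
  let ?N = "branch A B H x"
  have fin: "finite (sym_diff (p <# A) B)" if "p \<in> carrier G" for p
    by (rule finite_subset[of _ "sym_diff (p <# A) A \<union> sym_diff A B"])
      (use commensuratedD(2)[OF A that] AB in auto)
  have "finite (sym_diff (a <# ?N) ?N)" if a: "a \<in> carrier G" for a
  proof -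
    define F where "F = sym_diff (a <# A) A"
    define W where "W V p \<longleftrightarrow> (p <# V) \<inter> H = B \<inter> H \<and> x \<in> sym_diff (p <# V) B" for V p
    have F: "finite F" using commensuratedD(2)[OF A a] by (simp add: F_def)
    have aA: "a <# A \<subseteq> carrier G" using a sub by (auto simp: l_coset_def)
    have Fc: "F \<subseteq> carrier G" using aA sub by (auto simp: F_def)
    have fin': "finite (sym_diff (p <# (a <# A)) B)" if "p \<in> carrier G" for p
      using fin[of "p \<otimes> a"] that a sub by (simp add: lcos_m_assoc)
    define P where "P V z = {p \<in> carrier G. p \<otimes> z \<in> H \<and> W V p}" for V z
    define Q where "Q = (\<Union>z\<in>F. {x \<otimes> inv z} \<union> P A z \<union> P (a <# A) z)"
    have "finite Q"
      unfolding Q_def P_def W_def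
      using F Fc finite_branch_slice[OF H sub(2) sub(1) _ x fin]
        finite_branch_slice[OF H sub(2) aA _ x fin'] by blast
    moreover have "sym_diff (a <# ?N) ?N \<subseteq> (\<lambda>p. inv p) ` Q"
    proof
      fix g assume g: "g \<in> sym_diff (a <# ?N) ?N"
      have N: "?N \<subseteq> carrier G" by (auto simp: branch_def)
      have gc: "g \<in> carrier G" using g a N by (auto simp: l_coset_def)
      define p where "p = inv g"
      have pc: "p \<in> carrier G" using gc by (simp add: p_def)
      have "g \<in> ?N \<longleftrightarrow> W A p" using gc by (auto simp: branch_def W_def p_def)
      moreover have "g \<in> a <# ?N \<longleftrightarrow> W (a <# A) p"
      proof -
        have "inv (inv a \<otimes> g) = p \<otimes> a" using a gc by (simp add: p_def inv_mult_group)
        then show ?thesis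
          using a gc pc sub N by (auto simp: mem_l_coset_iff branch_def W_def lcos_m_assoc)
      qed
      ultimately have W: "W A p \<noteq> W (a <# A) p" using g by blast
      have "\<exists>z\<in>F. p \<otimes> z \<in> H \<or> p \<otimes> z = x"
      proof (rule ccontr)
        assume no: "\<not> ?thesis"
        have "y \<in> p <# A \<longleftrightarrow> y \<in> p <# (a <# A)" if y: "y \<in> H \<or> y = x" for y
        proof -
          have yc: "y \<in> carrier G" using y x by auto
          have "p \<otimes> (inv p \<otimes> y) = y" using pc yc by (simp add: m_assoc[symmetric])
          then have "inv p \<otimes> y \<notin> F" using no y by metis
          then show ?thesis using pc yc sub aA by (auto simp: mem_l_coset_iff F_def)
        qed
        then have "W A p \<longleftrightarrow> W (a <# A) p" unfolding W_def by blast
        with W show False by simp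
      qed
      then obtain z where z: "z \<in> F" "p \<otimes> z \<in> H \<or> p \<otimes> z = x" by blast
      have "p \<in> Q"
      proof (cases "p \<otimes> z = x")
        case True
        then have "p = x \<otimes> inv z" using pc z Fc by (auto simp: m_assoc)
        then show ?thesis using z by (auto simp: Q_def)
      next
        case False
        then have "p \<in> P A z \<union> P (a <# A) z" using z W pc by (auto simp: P_def)
        then show ?thesis using z by (auto simp: Q_def)
      qed
      moreover have "g = inv p" using gc by (simp add: p_def)
      ultimately show "g \<in> (\<lambda>p. inv p) ` Q" by blast
    qed
    ultimately show ?thesis by (meson finite_imageI finite_subset)
  qed
  then show ?thesis by (auto simp: commensurated_def branch_def)
qed

text \<open>For \<open>d \<in> K\<close> the set \<open>g d\<inverse> A\<close> differs from \<open>g A\<close> only inside \<open>g K\<close>, which is disjoint from \<open>K\<close>, so its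
  trace on \<open>K\<close> is still \<open>B \<inter> K\<close>. But it contains \<open>g\<close> iff \<open>d \<in> A\<close>, so infinitely many
  \<open>d \<in> K\<close> give an element \<open>d g\<inverse>\<close> of the branch at \<open>g\<close>.\<close>

lemma infinite_branch:
  assumes A: "A \<in> commensurated G" and K: "absorbs K A"
    and inf: "infinite (K \<inter> A)" "infinite (K - A)"
    and g: "g \<in> carrier G" "g \<notin> K" "(g <# A) \<inter> K = B \<inter> K"
  shows "infinite (branch A B K g)"
proof -
  interpret K: subgroup K G using K by (simp add: absorbs_def)
  have sub: "A \<subseteq> carrier G" using A by (rule commensuratedD)
  define D where "D = (if g \<in> B then K - A else K \<inter> A)"
  have DK: "D \<subseteq> K" by (auto simp: D_def)
  have "d \<otimes> inv g \<in> branch A B K g" if d: "d \<in> D" for d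
  proof -
    have dK: "d \<in> K" "inv d \<in> K" and dc: "d \<in> carrier G" using d DK by auto
    have eq: "inv (d \<otimes> inv g) = g \<otimes> inv d" using dc g by (simp add: inv_mult_group)
    have dA: "sym_diff (inv d <# A) A \<subseteq> K" using K dK by (simp add: absorbs_def)
    have idA: "inv d <# A \<subseteq> carrier G" using dc sub by (auto simp: l_coset_def)
    have coset: "(g \<otimes> inv d) <# A = g <# (inv d <# A)" using g dc sub by (simp add: lcos_m_assoc)
    have "y \<in> g <# (inv d <# A) \<longleftrightarrow> y \<in> g <# A" if y: "y \<in> K" for y
    proof -
      have yc: "y \<in> carrier G" using y by simp
      have "inv g \<otimes> y \<notin> K"
      proof
        assume "inv g \<otimes> y \<in> K"
        then have "y \<otimes> inv (inv g \<otimes> y) \<in> K" using y by simp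
        moreover have "y \<otimes> inv (inv g \<otimes> y) = g"
          using g yc by (simp add: inv_mult_group m_assoc[symmetric])
        ultimately show False using g by simp
      qed
      then show ?thesis using g yc sub idA dA by (auto simp: mem_l_coset_iff)
    qed
    then have "((g \<otimes> inv d) <# A) \<inter> K = B \<inter> K" using g(3) unfolding coset by blast
    moreover have "g \<in> (g \<otimes> inv d) <# A \<longleftrightarrow> d \<in> A"
      using g dc sub by (simp add: mem_l_coset_iff inv_mult_group m_assoc)
    ultimately show ?thesis
      using d dc g by (auto simp: branch_def eq D_def split: if_splits)
  qed
  then have "(\<lambda>d. d \<otimes> inv g) ` D \<subseteq> branch A B K g" by blast
  moreover have "inj_on (\<lambda>d. d \<otimes> inv g) D"
  proof (rule inj_onI)
    fix d e assume "d \<in> D" "e \<in> D" and eq: "d \<otimes> inv g = e \<otimes> inv g"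
    then have "d \<in> carrier G" "e \<in> carrier G" using DK by auto
    then show "d = e" using eq g by simp
  qed
  moreover have "infinite D" using inf by (simp add: D_def)
  ultimately show ?thesis by (meson finite_imageD finite_subset)
qed

text \<open>A maximal disjoint family of infinite branches with small parameters cannot be small: the
  branch at \<open>(K, g)\<close> consists of elements \<open>y\<close> for which \<open>y\<inverse> A\<close> agrees with \<open>B\<close> on \<open>K\<close>, in particular at
  all the points \<open>x N\<close> where the members of the family require disagreement.\<close>

lemma large_disjoint_family:
  assumes A: "A \<in> commensurated G" "infinite A" "infinite (carrier G - A)"
    and Z: "infinite Z" "|Z| <o |carrier G|"
  obtains \<N> where "\<N> \<subseteq> commensurated G" "\<And>N. N \<in> \<N> \<Longrightarrow> infinite N" "pairwise disjnt \<N>"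
    "|Z| <o |\<N>|"
proof -
  obtain B where B: "B \<in> commensurated G" "finite (sym_diff A B)"
    and rec: "\<And>K. |K| \<le>o |Z| \<Longrightarrow> \<exists>g\<in>carrier G - K. (g <# A) \<inter> K = B \<inter> K"
    by (rule recurrent_modification[OF A(1) Z]) blast
  define \<Q> where "\<Q> = {(H, x). |H| \<le>o |Z| \<and> absorbs H B \<and> x \<in> carrier G \<and> infinite (branch A B H x)}"
  define \<B> where "\<B> = (\<lambda>p. branch A B (fst p) (snd p)) ` \<Q>"
  define \<A> where "\<A> = {\<N>. \<N> \<subseteq> \<B> \<and> pairwise disjnt \<N>}"
  have "\<exists>\<N>\<in>\<A>. \<forall>\<M>\<in>\<A>. \<N> \<subseteq> \<M> \<longrightarrow> \<M> = \<N>"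
  proof (rule subset_Zorn')
    fix \<C> assume "subset.chain \<A> \<C>"
    then show "\<Union>\<C> \<in> \<A>"
      unfolding \<A>_def
      by (auto simp: subset_chain_def chain_subset_def intro!: pairwise_chain_Union)
  qed
  then obtain \<N> where \<N>_in: "\<N> \<in> \<A>" and \<N>_max: "\<forall>\<M>\<in>\<A>. \<N> \<subseteq> \<M> \<longrightarrow> \<M> = \<N>" ..
  then have \<N>: "\<N> \<subseteq> \<B>" "pairwise disjnt \<N>" by (simp_all add: \<A>_def)
  have max: "\<M> = \<N>" if "\<M> \<subseteq> \<B>" "pairwise disjnt \<M>" "\<N> \<subseteq> \<M>" for \<M>
    using \<N>_max that by (simp add: \<A>_def)
  have "\<not> |\<N>| \<le>o |Z|"
  proof
    assume le: "|\<N>| \<le>o |Z|"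
    have "\<exists>p\<in>\<Q>. N = branch A B (fst p) (snd p)" if "N \<in> \<N>" for N
      using \<N>(1) that unfolding \<B>_def by blast
    then obtain p where p: "\<And>N. N \<in> \<N> \<Longrightarrow> p N \<in> \<Q>"
      "\<And>N. N \<in> \<N> \<Longrightarrow> N = branch A B (fst (p N)) (snd (p N))"
      by metis
    define H x where "H N = fst (p N)" and "x N = snd (p N)" for N
    have Hx: "(H N, x N) \<in> \<Q>" "N = branch A B (H N) (x N)" if "N \<in> \<N>" for N
      using p[OF that] by (simp_all add: H_def x_def)
    obtain I where I: "I \<subseteq> A" "countable I" "infinite I"
      using infinite_countable_subset'[OF A(2)] by blast
    obtain J where J: "J \<subseteq> carrier G - A" "countable J" "infinite J"
      using infinite_countable_subset'[OF A(3)] by blast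
    define X where "X = (\<Union>N\<in>\<N>. insert (x N) (H N)) \<union> (I \<union> J)"
    have cIJ: "|I \<union> J| \<le>o |Z|"
      using I(2) J(2) Z(1) by (simp add: countable_ordLeq_infinite)
    have ins: "|insert (x N) (H N)| \<le>o |Z|" if "N \<in> \<N>" for N
      using Hx(1)[OF that] Z(1)
        card_of_Un_ordLeq_infinite[OF Z(1), of "{x N}" "H N"]
      by (simp add: \<Q>_def finite_ordLess_infinite2 ordLess_imp_ordLeq)
    have "|X| \<le>o |Z|"
      unfolding X_def
      by (rule card_of_Un_ordLeq_infinite[OF Z(1) card_of_UNION_ordLeq_infinite[OF Z(1) le] cIJ])
        (use ins in blast)
    moreover have "X \<subseteq> carrier G"
    proof -
      have "insert (x N) (H N) \<subseteq> carrier G" if "N \<in> \<N>" for N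
        using Hx(1)[OF that] by (auto simp: \<Q>_def absorbs_def dest: subgroup.subset)
      then show ?thesis using I(1) J(1) commensuratedD(1)[OF A(1)] unfolding X_def by blast
    qed
    ultimately obtain K where K: "X \<subseteq> K" "|K| \<le>o |Z|" "absorbs K A" "absorbs K B"
      using absorbing_hull[OF A(1) B(1) Z(1), of X] by metis
    obtain g where g: "g \<in> carrier G" "g \<notin> K" "(g <# A) \<inter> K = B \<inter> K" using rec[OF K(2)] by blast
    have "I \<subseteq> K \<inter> A" "J \<subseteq> K - A" using I(1) J(1) K(1) by (auto simp: X_def)
    then have inf: "infinite (branch A B K g)"
      using infinite_branch[OF A(1) K(3) infinite_super[OF _ I(3)] infinite_super[OF _ J(3)] g] by blast
    have "(K, g) \<in> \<Q>" using K(2,4) g(1) inf by (simp add: \<Q>_def)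
    then have new: "branch A B K g \<in> \<B>" unfolding \<B>_def by (rule rev_image_eqI) simp
    have dis: "disjnt (branch A B K g) N" if N: "N \<in> \<N>" for N
    proof -
      have "x N \<in> K" using K(1) N by (auto simp: X_def)
      then have "disjnt (branch A B K g) (branch A B (H N) (x N))"
        by (auto simp: disjnt_def branch_def)
      then show ?thesis using Hx(2)[OF N] by simp
    qed
    have "insert (branch A B K g) \<N> = \<N>"
    proof (rule max)
      show "pairwise disjnt (insert (branch A B K g) \<N>)"
        using \<N>(2) dis by (simp add: pairwise_insert disjnt_sym)
    qed (use new \<N>(1) in auto)
    then have "disjnt (branch A B K g) (branch A B K g)" using dis by blast
    with inf show False by (simp add: disjnt_self_iff_empty)
  qed
  then have "|Z| <o |\<N>|" by (simp add: not_ordLeq_iff_ordLess)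
  moreover have "N \<in> commensurated G \<and> infinite N" if "N \<in> \<N>" for N
    using that \<N>(1) branch_commensurated[OF A(1) B] by (auto simp: \<B>_def \<Q>_def)
  ultimately show ?thesis using \<N>(2) that by blast
qed

section \<open>Almost disjoint families are not larger than the group\<close>

text \<open>If \<open>A\<close> were countable, some \<open>g\<close> would lie outside the countable set \<open>A A\<inverse>\<close>; then \<open>g A\<close> would be
  disjoint from \<open>A\<close>.\<close>

lemma infinite_commensurated_uncountable:
  assumes G: "uncountable (carrier G)" and A: "A \<in> commensurated G" "infinite A"
  shows "uncountable A"
proof
  assume "countable A"
  have sub: "A \<subseteq> carrier G" using A(1) by (rule commensuratedD)
  have "countable ((\<lambda>(a, b). a \<otimes> inv b) ` (A \<times> A))" using \<open>countable A\<close> by simp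
  then have "\<not> carrier G \<subseteq> (\<lambda>(a, b). a \<otimes> inv b) ` (A \<times> A)"
    using G by (metis countable_subset)
  then obtain g where g: "g \<in> carrier G" "g \<notin> (\<lambda>(a, b). a \<otimes> inv b) ` (A \<times> A)"
    unfolding subset_iff by metis
  have "(g <# A) \<inter> A = {}"
  proof (rule ccontr)
    assume "(g <# A) \<inter> A \<noteq> {}"
    then obtain b where b: "b \<in> A" "g \<otimes> b \<in> A" by (auto simp: l_coset_def)
    then have "g = (\<lambda>(a, b). a \<otimes> inv b) (g \<otimes> b, b)" using sub g by (auto simp: m_assoc)
    with g b show False by blast
  qed
  then have "A \<subseteq> sym_diff (g <# A) A" by blast
  then have "finite A" using commensuratedD(2)[OF A(1) g(1)] by (rule finite_subset)
  with A(2) show False by simp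
qed

lemma commensurated_contains_translate:
  assumes A: "A \<in> commensurated G" "uncountable A" and S: "countable S" "S \<subseteq> carrier G"
  shows "\<exists>x\<in>A. \<forall>s\<in>S. s \<otimes> x \<in> A"
proof -
  have sub: "A \<subseteq> carrier G" using A(1) by (rule commensuratedD)
  have "countable (\<Union>s\<in>S. sym_diff (inv s <# A) A)"
  proof (rule countable_UN[OF S(1)], rule countable_finite)
    fix s assume "s \<in> S"
    then have "inv s \<in> carrier G" using S(2) by auto
    then show "finite (sym_diff (inv s <# A) A)" by (rule commensuratedD(2)[OF A(1)])
  qed
  then have "\<not> A \<subseteq> (\<Union>s\<in>S. sym_diff (inv s <# A) A)"
    using A(2) by (metis countable_subset)
  then obtain x where x: "x \<in> A" "x \<notin> (\<Union>s\<in>S. sym_diff (inv s <# A) A)"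
    unfolding subset_iff by metis
  have "s \<otimes> x \<in> A" if s: "s \<in> S" for s
  proof -
    have "x \<in> inv s <# A" using x s by blast
    moreover have "s \<in> carrier G" "x \<in> carrier G" using s S(2) x(1) sub by auto
    ultimately show ?thesis using mem_l_coset_iff[of "inv s" x A] sub by simp
  qed
  with x(1) show ?thesis by blast
qed

lemma almost_disjoint_family_ordLeq:
  assumes G: "uncountable (carrier G)"
    and A: "\<And>i. i \<in> I \<Longrightarrow> A i \<in> commensurated G" "\<And>i. i \<in> I \<Longrightarrow> infinite (A i)"
    and ad: "\<And>i j. i \<in> I \<Longrightarrow> j \<in> I \<Longrightarrow> i \<noteq> j \<Longrightarrow> finite (A i \<inter> A j)"
  shows "|I| \<le>o |carrier G|"
proof -
  have "infinite (carrier G)" using G by (rule uncountable_infinite)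
  then obtain S where S: "S \<subseteq> carrier G" "countable S" "infinite S"
    using infinite_countable_subset'[of "carrier G"] by blast
  have "\<exists>x. x \<in> A i \<and> (\<forall>s\<in>S. s \<otimes> x \<in> A i)" if "i \<in> I" for i
    using commensurated_contains_translate[OF A(1)[OF that] _ S(2,1)]
      infinite_commensurated_uncountable[OF G A(1)[OF that] A(2)[OF that]] by blast
  then obtain x where x: "\<And>i. i \<in> I \<Longrightarrow> x i \<in> A i \<and> (\<forall>s\<in>S. s \<otimes> x i \<in> A i)" by metis
  have xG: "x i \<in> carrier G" if "i \<in> I" for i
    using x[OF that] commensuratedD(1)[OF A(1)[OF that]] by blast
  have "inj_on x I"
  proof (rule inj_onI, rule ccontr)
    fix i j assume ij: "i \<in> I" "j \<in> I" "x i = x j" "i \<noteq> j"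
    have "(\<lambda>s. s \<otimes> x i) ` S \<subseteq> A i \<inter> A j" using x[OF ij(1)] x[OF ij(2)] ij(3) by auto
    then have "finite ((\<lambda>s. s \<otimes> x i) ` S)" using ad[OF ij(1,2,4)] by (rule finite_subset)
    moreover have "inj_on (\<lambda>s. s \<otimes> x i) S"
      using S(1) xG[OF ij(1)] by (auto simp: inj_on_def subset_iff)
    ultimately show False using S(3) finite_imageD by blast
  qed
  moreover have "x ` I \<subseteq> carrier G" using xG by auto
  ultimately show ?thesis using card_of_ordLeq[of I "carrier G"] by blast
qed

section \<open>Ultrafilters of the algebra of ends\<close>

lemma lattice_filterD:
  assumes "lattice_filter (ends_algebra G) F"
  shows "F \<subseteq> carrier (ends_algebra G)" "F \<noteq> {}"
    "\<And>A B. A \<in> commensurated G \<Longrightarrow> B \<in> commensurated G \<Longrightarrow>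
       ends_class A \<in> F \<Longrightarrow> ends_class B \<in> F \<Longrightarrow> ends_class (A \<inter> B) \<in> F"
    "\<And>A B. A \<in> commensurated G \<Longrightarrow> B \<in> commensurated G \<Longrightarrow>
       ends_class A \<in> F \<Longrightarrow> finite (A - B) \<Longrightarrow> ends_class B \<in> F"
proof -
  show "F \<subseteq> carrier (ends_algebra G)" "F \<noteq> {}"
    using assms by (simp_all add: lattice_filter_def)
next
  fix A B assume "A \<in> commensurated G" "B \<in> commensurated G" "ends_class A \<in> F" "ends_class B \<in> F"
  then show "ends_class (A \<inter> B) \<in> F"
    using assms by (metis lattice_filter_def meet_ends_class)
next
  fix A B assume "A \<in> commensurated G" "B \<in> commensurated G" "ends_class A \<in> F" "finite (A - B)"
  then show "ends_class B \<in> F"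
    using assms ends_class_in[of B] ends_class_le_iff[of A B] unfolding lattice_filter_def by blast
qed

lemma lattice_filterI:
  assumes sub: "F \<subseteq> carrier (ends_algebra G)" and ne: "F \<noteq> {}"
    and meet: "\<And>A B. A \<in> commensurated G \<Longrightarrow> B \<in> commensurated G \<Longrightarrow>
       ends_class A \<in> F \<Longrightarrow> ends_class B \<in> F \<Longrightarrow> ends_class (A \<inter> B) \<in> F"
    and up: "\<And>A B. A \<in> commensurated G \<Longrightarrow> B \<in> commensurated G \<Longrightarrow>
       ends_class A \<in> F \<Longrightarrow> finite (A - B) \<Longrightarrow> ends_class B \<in> F"
  shows "lattice_filter (ends_algebra G) F"
  unfolding lattice_filter_def
proof (intro conjI ballI impI)
  fix x y assume xy: "x \<in> F" "y \<in> F"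
  obtain A where A: "A \<in> commensurated G" "x = ends_class A" 
    by (rule ends_class_cases[OF subsetD[OF sub xy(1)]])
  obtain B where B: "B \<in> commensurated G" "y = ends_class B" 
    by (rule ends_class_cases[OF subsetD[OF sub xy(2)]])
  have "ends_class (A \<inter> B) \<in> F" using meet[OF A(1) B(1)] xy A(2) B(2) by simp
  then show "x \<sqinter>\<^bsub>ends_algebra G\<^esub> y \<in> F"
    by (simp only: A(2) B(2) meet_ends_class[OF A(1) B(1)])
next
  fix x y assume xy: "x \<in> F" "y \<in> carrier (ends_algebra G)" and le: "x \<sqsubseteq>\<^bsub>ends_algebra G\<^esub> y"
  obtain A where A: "A \<in> commensurated G" "x = ends_class A" 
    by (rule ends_class_cases[OF subsetD[OF sub xy(1)]])
  obtain B where B: "B \<in> commensurated G" "y = ends_class B" 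
    by (rule ends_class_cases[OF xy(2)])
  have "finite (A - B)" using le unfolding A(2) B(2) ends_class_le_iff[OF A(1) B(1)] .
  then show "y \<in> F" using up[OF A(1) B(1)] xy A(2) B(2) by simp
qed (use sub ne in blast)+

lemma proper_filter_iff:
  assumes F: "lattice_filter (ends_algebra G) F"
  shows "F \<noteq> carrier (ends_algebra G) \<longleftrightarrow> ends_class {} \<notin> F"
proof -
  have "F = carrier (ends_algebra G)" if e: "ends_class {} \<in> F"
  proof
    show "carrier (ends_algebra G) \<subseteq> F"
    proof
      fix x assume "x \<in> carrier (ends_algebra G)"
      then obtain A where A: "A \<in> commensurated G" "x = ends_class A" by (rule ends_class_cases)
      then show "x \<in> F" using lattice_filterD(4)[OF F empty_commensurated A(1) e] by simp
    qed
  qed (rule lattice_filterD[OF F])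
  then show ?thesis using ends_class_in[OF empty_commensurated] by blast
qed

lemma ultrafilter_extension:
  assumes F: "lattice_filter (ends_algebra G) F" "ends_class {} \<notin> F"
  obtains U where "lattice_ultrafilter (ends_algebra G) U" "F \<subseteq> U"
proof -
  define \<A> where "\<A> = {F'. lattice_filter (ends_algebra G) F' \<and> ends_class {} \<notin> F' \<and> F \<subseteq> F'}"
  have "\<exists>U\<in>\<A>. \<forall>X\<in>\<A>. U \<subseteq> X \<longrightarrow> X = U"
  proof (rule subset_Zorn_nonempty)
    show "\<A> \<noteq> {}" using F by (auto simp: \<A>_def)
    fix \<C> assume ne: "\<C> \<noteq> {}" and ch: "subset.chain \<A> \<C>"
    have filt: "lattice_filter (ends_algebra G) S" "ends_class {} \<notin> S" "F \<subseteq> S" if "S \<in> \<C>" for S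
      using ch that by (auto simp: subset_chain_def \<A>_def)
    have "lattice_filter (ends_algebra G) (\<Union>\<C>)"
    proof (rule lattice_filterI)
      show "\<Union>\<C> \<subseteq> carrier (ends_algebra G)" using lattice_filterD(1)[OF filt(1)] by blast
      show "\<Union>\<C> \<noteq> {}" using lattice_filterD(2)[OF filt(1)] ne by blast
    next
      fix A B assume AB: "A \<in> commensurated G" "B \<in> commensurated G"
        and "ends_class A \<in> \<Union>\<C>" "ends_class B \<in> \<Union>\<C>"
      then obtain S T where ST: "S \<in> \<C>" "T \<in> \<C>" "ends_class A \<in> S" "ends_class B \<in> T" by blast
      define M where "M = S \<union> T"
      have "M \<in> \<C>" using ch ST unfolding M_def subset_chain_def by (metis sup.absorb1 sup.absorb2)
      moreover have "ends_class A \<in> M" "ends_class B \<in> M" using ST by (simp_all add: M_def)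
      ultimately show "ends_class (A \<inter> B) \<in> \<Union>\<C>"
        using lattice_filterD(3)[OF filt(1) AB] by blast
    next
      fix A B assume "A \<in> commensurated G" "B \<in> commensurated G"
        "ends_class A \<in> \<Union>\<C>" "finite (A - B)"
      then show "ends_class B \<in> \<Union>\<C>" using lattice_filterD(4)[OF filt(1)] by blast
    qed
    moreover obtain S where "S \<in> \<C>" using ne by blast
    then have "F \<subseteq> \<Union>\<C>" using filt(3) by blast
    ultimately show "\<Union>\<C> \<in> \<A>" using filt(2) by (simp add: \<A>_def)
  qed
  then obtain U where U: "U \<in> \<A>" "\<forall>X\<in>\<A>. U \<subseteq> X \<longrightarrow> X = U" ..
  then have *: "lattice_filter (ends_algebra G) U" "ends_class {} \<notin> U" "F \<subseteq> U"
    by (simp_all add: \<A>_def)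
  have "lattice_ultrafilter (ends_algebra G) U"
    unfolding lattice_ultrafilter_def
  proof (intro conjI allI impI)
    show "U \<noteq> carrier (ends_algebra G)" using proper_filter_iff[OF *(1)] *(2) by simp
    fix X assume X: "lattice_filter (ends_algebra G) X \<and> X \<noteq> carrier (ends_algebra G) \<and> U \<subseteq> X"
    then have "ends_class {} \<notin> X" using proper_filter_iff[of X] by simp
    then have "X \<in> \<A>" using X *(3) by (auto simp: \<A>_def)
    then show "X = U" using U(2) X by blast
  qed (rule *)
  then show ?thesis using *(3) by (rule that)
qed

text \<open>The filter generated by \<open>\<B>\<close> consists of the classes of the commensurated sets that contain a
  finite intersection from \<open>\<B>\<close> up to a finite set.\<close>

lemma ultrafilter_with_finite_intersections:
  assumes \<B>: "\<B> \<subseteq> commensurated G"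
    and fip: "\<And>\<F>. finite \<F> \<Longrightarrow> \<F> \<subseteq> \<B> \<Longrightarrow> infinite (carrier G \<inter> \<Inter>\<F>)"
  shows "\<exists>U. lattice_ultrafilter (ends_algebra G) U \<and> (\<forall>B\<in>\<B>. ends_class B \<in> U)"
proof -
  define P where "P C \<longleftrightarrow> (\<exists>\<F>. finite \<F> \<and> \<F> \<subseteq> \<B> \<and> finite (carrier G \<inter> \<Inter>\<F> - C))" for C
  have P_up: "P D" if "P C" "finite (C - D)" for C D
  proof -
    obtain \<F> where \<F>: "finite \<F>" "\<F> \<subseteq> \<B>" "finite (carrier G \<inter> \<Inter>\<F> - C)"
      using \<open>P C\<close> by (auto simp: P_def)
    have "finite (carrier G \<inter> \<Inter>\<F> - D)"
      by (rule finite_subset[OF _ finite_UnI[OF \<F>(3) \<open>finite (C - D)\<close>]]) blast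
    then show ?thesis using \<F> by (auto simp: P_def)
  qed
  have P_Int: "P (C \<inter> D)" if CD: "P C" "P D" for C D
  proof -
    obtain \<F> where \<F>: "finite \<F>" "\<F> \<subseteq> \<B>" "finite (carrier G \<inter> \<Inter>\<F> - C)"
      using \<open>P C\<close> by (auto simp: P_def)
    obtain \<H> where \<H>: "finite \<H>" "\<H> \<subseteq> \<B>" "finite (carrier G \<inter> \<Inter>\<H> - D)"
      using \<open>P D\<close> by (auto simp: P_def)
    have "finite (carrier G \<inter> \<Inter>(\<F> \<union> \<H>) - C \<inter> D)"
      by (rule finite_subset[OF _ finite_UnI[OF \<F>(3) \<H>(3)]]) blast
    then show ?thesis unfolding P_def using \<F>(1,2) \<H>(1,2) by (meson finite_UnI le_sup_iff)
  qed
  define F where "F = ends_class ` {C \<in> commensurated G. P C}"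
  have F_iff: "ends_class C \<in> F \<longleftrightarrow> P C" if C: "C \<in> commensurated G" for C
  proof
    assume "ends_class C \<in> F"
    then obtain D where D: "D \<in> commensurated G" "P D" "ends_class C = ends_class D"
      by (auto simp: F_def)
    then have "finite (D - C)" using ends_class_eq_iff[OF C D(1)] by simp
    then show "P C" using D(2) P_up by blast
  qed (use C in \<open>auto simp: F_def\<close>)
  have PG: "P (carrier G)" unfolding P_def by (rule exI[of _ "{}"]) simp
  have "lattice_filter (ends_algebra G) F"
  proof (rule lattice_filterI)
    show "F \<subseteq> carrier (ends_algebra G)" by (auto simp: F_def intro: ends_class_in)
    show "F \<noteq> {}" using F_iff[OF carrier_commensurated] PG by blast
  next
    fix A B assume AB: "A \<in> commensurated G" "B \<in> commensurated G" "ends_class A \<in> F" "ends_class B \<in> F"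
    then show "ends_class (A \<inter> B) \<in> F" using P_Int by (simp only: F_iff Int_commensurated)
  next
    fix A B assume AB: "A \<in> commensurated G" "B \<in> commensurated G" "ends_class A \<in> F" "finite (A - B)"
    then show "ends_class B \<in> F" using P_up by (simp only: F_iff)
  qed
  moreover have "\<not> P {}" using fip by (auto simp: P_def)
  then have "ends_class {} \<notin> F" using F_iff[OF empty_commensurated] by blast
  ultimately obtain U where U: "lattice_ultrafilter (ends_algebra G) U" "F \<subseteq> U"
    by (rule ultrafilter_extension)
  have "ends_class B \<in> U" if B: "B \<in> \<B>" for B
  proof -
    have "finite (carrier G \<inter> \<Inter>{B} - B)" by (rule finite_subset[of _ "{}"]) auto
    then have "P B" unfolding P_def using B by (intro exI[of _ "{B}"]) simp
    then show ?thesis using F_iff[of B] B \<B> U(2) by blast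
  qed
  with U(1) show ?thesis by blast
qed

lemma ultrafilterD:
  assumes U: "lattice_ultrafilter (ends_algebra G) U"
  shows "lattice_filter (ends_algebra G) U" "ends_class {} \<notin> U"
    "\<And>V. lattice_ultrafilter (ends_algebra G) V \<Longrightarrow> U \<subseteq> V \<Longrightarrow> V = U"
proof -
  show 1: "lattice_filter (ends_algebra G) U" using U by (simp add: lattice_ultrafilter_def)
  show "ends_class {} \<notin> U" using proper_filter_iff[OF 1] U by (simp add: lattice_ultrafilter_def)
  show "V = U" if "lattice_ultrafilter (ends_algebra G) V" "U \<subseteq> V" for V
    using U that unfolding lattice_ultrafilter_def by blast
qed

lemma ultrafilter_infinite:
  assumes "lattice_ultrafilter (ends_algebra G) U" "A \<in> commensurated G" "ends_class A \<in> U"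
  shows "infinite A"
  using lattice_filterD(4)[OF ultrafilterD(1)[OF assms(1)] assms(2) empty_commensurated assms(3)]
    ultrafilterD(2)[OF assms(1)] by auto

lemma ultrafilter_Inter:
  assumes U: "lattice_ultrafilter (ends_algebra G) U"
    and "finite \<F>" "\<And>D. D \<in> \<F> \<Longrightarrow> D \<in> commensurated G \<and> ends_class D \<in> U"
  shows "carrier G \<inter> \<Inter>\<F> \<in> commensurated G \<and> ends_class (carrier G \<inter> \<Inter>\<F>) \<in> U"
  using assms(2,3)
proof (induction \<F>)
  case empty
  note F = ultrafilterD(1)[OF U]
  obtain x where x: "x \<in> U" using lattice_filterD(2)[OF F] by blast
  obtain A where A: "A \<in> commensurated G" "x = ends_class A"
    by (rule ends_class_cases[OF subsetD[OF lattice_filterD(1)[OF F] x]])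
  have "finite (A - carrier G)" using commensuratedD(1)[OF A(1)] by (simp add: Diff_eq_empty_iff[THEN iffD2])
  then show ?case
    using lattice_filterD(4)[OF F A(1) carrier_commensurated] x A(2) carrier_commensurated by simp
next
  case (insert D \<F>)
  have eq: "carrier G \<inter> \<Inter>(insert D \<F>) = D \<inter> (carrier G \<inter> \<Inter>\<F>)" by blast
  show ?case unfolding eq
    using insert lattice_filterD(3)[OF ultrafilterD(1)[OF U]] Int_commensurated by simp
qed

text \<open>Otherwise \<open>A\<close> meets every set of the ultrafilter in an infinite set, and a strictly
  larger ultrafilter contains its class.\<close>

lemma not_in_ultrafilter:
  assumes U: "lattice_ultrafilter (ends_algebra G) U" and A: "A \<in> commensurated G" "ends_class A \<notin> U"
  obtains D where "D \<in> commensurated G" "ends_class D \<in> U" "finite (A \<inter> D)"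
proof (rule ccontr)
  assume "\<not> thesis"
  then have inf: "infinite (A \<inter> D)" if "D \<in> commensurated G" "ends_class D \<in> U" for D
    using that \<open>\<And>D. D \<in> commensurated G \<Longrightarrow> ends_class D \<in> U \<Longrightarrow> finite (A \<inter> D) \<Longrightarrow> thesis\<close> by blast
  let ?\<B> = "insert A {D \<in> commensurated G. ends_class D \<in> U}"
  have "infinite (carrier G \<inter> \<Inter>\<F>)" if \<F>: "finite \<F>" "\<F> \<subseteq> ?\<B>" for \<F>
  proof -
    have *: "carrier G \<inter> \<Inter>(\<F> - {A}) \<in> commensurated G \<and> ends_class (carrier G \<inter> \<Inter>(\<F> - {A})) \<in> U"
      by (rule ultrafilter_Inter[OF U]) (use \<F> in auto)
    have "infinite (A \<inter> (carrier G \<inter> \<Inter>(\<F> - {A})))" using inf * by blast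
    moreover have "A \<inter> (carrier G \<inter> \<Inter>(\<F> - {A})) \<subseteq> carrier G \<inter> \<Inter>\<F>" by blast
    ultimately show ?thesis using finite_subset by blast
  qed
  then have "\<exists>V. lattice_ultrafilter (ends_algebra G) V \<and> (\<forall>B\<in>?\<B>. ends_class B \<in> V)"
    using A(1) by (intro ultrafilter_with_finite_intersections) auto
  then obtain V where V: "lattice_ultrafilter (ends_algebra G) V" "\<And>B. B \<in> ?\<B> \<Longrightarrow> ends_class B \<in> V"
    by blast
  have "U \<subseteq> V"
  proof
    fix x assume x: "x \<in> U"
    then have "x \<in> carrier (ends_algebra G)" using lattice_filterD(1)[OF ultrafilterD(1)[OF U]] by blast
    then obtain D where "D \<in> commensurated G" "x = ends_class D" by (rule ends_class_cases)
    then show "x \<in> V" using V(2)[of D] x by simp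
  qed
  then have "V = U" using ultrafilterD(3)[OF U V(1)] by simp
  with V(2)[of A] A(2) show False by simp
qed

section \<open>The topology of the space of ends\<close>

definition stone_set :: "'a set \<Rightarrow> 'a set set set set" where
  "stone_set A = {U. lattice_ultrafilter (ends_algebra G) U \<and> ends_class A \<in> U}"

lemma stone_set_nonempty_iff:
  assumes "A \<in> commensurated G"
  shows "stone_set A \<noteq> {} \<longleftrightarrow> infinite A"
proof
  assume "infinite A"
  have "infinite (carrier G \<inter> \<Inter>\<F>)" if "\<F> \<subseteq> {A}" for \<F>
  proof -
    have "A \<subseteq> carrier G \<inter> \<Inter>\<F>" using that commensuratedD(1)[OF assms] by blast
    then show ?thesis using \<open>infinite A\<close> by (rule infinite_super)
  qed
  then have "\<exists>U. lattice_ultrafilter (ends_algebra G) U \<and> (\<forall>B\<in>{A}. ends_class B \<in> U)"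
    using assms by (intro ultrafilter_with_finite_intersections) auto
  then show "stone_set A \<noteq> {}" unfolding stone_set_def by blast
next
  assume "stone_set A \<noteq> {}"
  then obtain U where "lattice_ultrafilter (ends_algebra G) U" "ends_class A \<in> U"
    unfolding stone_set_def by blast
  then show "infinite A" using ultrafilter_infinite[OF _ assms] by blast
qed

lemma stone_set_Int:
  assumes A: "A \<in> commensurated G" and B: "B \<in> commensurated G"
  shows "stone_set A \<inter> stone_set B = stone_set (A \<inter> B)"
proof -
  have "ends_class (A \<inter> B) \<in> U \<longleftrightarrow> ends_class A \<in> U \<and> ends_class B \<in> U"
    if "lattice_ultrafilter (ends_algebra G) U" for U
  proof -
    note F = ultrafilterD(1)[OF that]
    have "finite (A \<inter> B - A)" "finite (A \<inter> B - B)" by (simp_all add: Int_Diff)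
    then show ?thesis
      using lattice_filterD(3)[OF F A B] lattice_filterD(4)[OF F Int_commensurated[OF A B]] A B by blast
  qed
  then show ?thesis by (auto simp: stone_set_def)
qed

lemma ends_space_alt: "ends_space G = topology_generated_by (stone_set ` commensurated G)"
proof -
  have "carrier (ends_algebra G) = ends_class ` commensurated G"
    by (auto intro: ends_class_in elim: ends_class_cases)
  then show ?thesis by (simp add: ends_space_def stone_dual_def stone_set_def image_image)
qed

lemma openin_stone_set: "A \<in> commensurated G \<Longrightarrow> openin (ends_space G) (stone_set A)"
  unfolding ends_space_alt by (rule topology_generated_by_Basis) simp

lemma stone_set_base:
  assumes "openin (ends_space G) W" "U \<in> W"
  shows "\<exists>A\<in>commensurated G. U \<in> stone_set A \<and> stone_set A \<subseteq> W"
proof -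
  have "generate_topology_on (stone_set ` commensurated G) W"
    using assms(1) unfolding ends_space_alt openin_topology_generated_by_iff .
  then show ?thesis
    using assms(2)
  proof induction
    case (Int a b)
    then obtain A B where "A \<in> commensurated G" "B \<in> commensurated G"
      "U \<in> stone_set A \<inter> stone_set B" "stone_set A \<inter> stone_set B \<subseteq> a \<inter> b" by blast
    then show ?case using stone_set_Int[of A B] Int_commensurated[of A B] by auto
  next
    case (UN K)
    then show ?case by (meson Sup_upper UnionE subset_trans)
  qed auto
qed

text \<open>If no finite intersection of the complements \<open>G - A\<close> were finite, an ultrafilter would contain the
  classes of all these complements and thus lie in no set of the cover. A finite set \<open>I\<close> whose complements
  have a finite intersection gives a subcover: an ultrafilter missing every \<open>A \<in> I\<close>
  contains the class of a set almost disjoint from each of them, which would be finite.\<close>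

lemma finite_stone_subcover:
  assumes \<A>: "\<A> \<subseteq> commensurated G" and cover: "topspace (ends_space G) \<subseteq> (\<Union>A\<in>\<A>. stone_set A)"
  shows "\<exists>I. finite I \<and> I \<subseteq> \<A> \<and> topspace (ends_space G) \<subseteq> (\<Union>A\<in>I. stone_set A)"
proof -
  have "\<exists>\<F>. finite \<F> \<and> \<F> \<subseteq> (\<lambda>A. carrier G - A) ` \<A> \<and> finite (carrier G \<inter> \<Inter>\<F>)"
  proof (rule ccontr)
    assume no: "\<not> ?thesis"
    have sub: "(\<lambda>A. carrier G - A) ` \<A> \<subseteq> commensurated G"
      using \<A> Diff_commensurated[OF carrier_commensurated] by blast
    have "\<exists>U. lattice_ultrafilter (ends_algebra G) U \<and>
        (\<forall>B\<in>(\<lambda>A. carrier G - A) ` \<A>. ends_class B \<in> U)"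
      by (rule ultrafilter_with_finite_intersections[OF sub]) (use no in blast)
    then obtain U where U: "lattice_ultrafilter (ends_algebra G) U"
      "\<And>B. B \<in> (\<lambda>A. carrier G - A) ` \<A> \<Longrightarrow> ends_class B \<in> U"
      by blast
    have "U \<in> topspace (ends_space G)" using U(1) by (simp add: topspace_ends_space)
    then obtain A where A: "A \<in> \<A>" "U \<in> stone_set A" using cover by blast
    have Ac: "A \<in> commensurated G" "carrier G - A \<in> commensurated G" using A(1) \<A> sub by auto
    have "U \<in> stone_set (carrier G - A)" using A(1) U by (simp add: stone_set_def)
    then have "stone_set (A \<inter> (carrier G - A)) \<noteq> {}"
      using stone_set_Int[OF Ac] A(2) by blast
    then show False
      using stone_set_nonempty_iff[OF empty_commensurated] by simp
  qed
  then obtain \<F> where \<F>: "finite \<F>" "\<F> \<subseteq> (\<lambda>A. carrier G - A) ` \<A>" "finite (carrier G \<inter> \<Inter>\<F>)"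
    by blast
  then obtain I where I: "I \<subseteq> \<A>" "finite I" "\<F> = (\<lambda>A. carrier G - A) ` I"
    by (meson finite_subset_image)
  have "U \<in> (\<Union>A\<in>I. stone_set A)" if "U \<in> topspace (ends_space G)" for U
  proof (rule ccontr)
    assume notin: "U \<notin> (\<Union>A\<in>I. stone_set A)"
    have U: "lattice_ultrafilter (ends_algebra G) U" using that by (simp add: topspace_ends_space)
    have "\<exists>D. D \<in> commensurated G \<and> ends_class D \<in> U \<and> finite (A \<inter> D)" if A: "A \<in> I" for A
    proof -
      have "A \<in> commensurated G" "ends_class A \<notin> U"
        using A I(1) \<A> notin U by (auto simp: stone_set_def simp del: Image_singleton_iff)
      then show ?thesis by (rule not_in_ultrafilter[OF U]) blast
    qed
    then obtain D where D: "\<And>A. A \<in> I \<Longrightarrow> D A \<in> commensurated G \<and> ends_class (D A) \<in> U \<and> finite (A \<inter> D A)"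
      by metis
    define E where "E = carrier G \<inter> \<Inter>(D ` I)"
    have E: "E \<in> commensurated G \<and> ends_class E \<in> U"
      unfolding E_def by (rule ultrafilter_Inter[OF U]) (use D I(2) in auto)
    have "E \<subseteq> (carrier G \<inter> \<Inter>\<F>) \<union> (\<Union>A\<in>I. A \<inter> D A)" unfolding E_def I(3) by blast
    moreover have "finite \<dots>" using \<F>(3) D I(2) by simp
    ultimately have "finite E" by (rule finite_subset)
    with ultrafilter_infinite[OF U] E show False by blast
  qed
  then have "topspace (ends_space G) \<subseteq> (\<Union>A\<in>I. stone_set A)" by blast
  with I(2,1) show ?thesis by blast
qed

lemma compact_ends_space: "compact_space (ends_space G)"
  unfolding compact_space_alt
proof (intro allI impI)
  fix \<U> assume \<U>: "(\<forall>W\<in>\<U>. openin (ends_space G) W) \<and> topspace (ends_space G) \<subseteq> \<Union>\<U>"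
  define \<A> where "\<A> = {A \<in> commensurated G. \<exists>W\<in>\<U>. stone_set A \<subseteq> W}"
  have "U \<in> (\<Union>A\<in>\<A>. stone_set A)" if U: "U \<in> topspace (ends_space G)" for U
  proof -
    obtain W where "W \<in> \<U>" "U \<in> W" using U \<U> by blast
    then show ?thesis using stone_set_base[of W U] \<U> unfolding \<A>_def by blast
  qed
  then have "topspace (ends_space G) \<subseteq> (\<Union>A\<in>\<A>. stone_set A)" by blast
  moreover have "\<A> \<subseteq> commensurated G" by (auto simp: \<A>_def)
  ultimately have "\<exists>I. finite I \<and> I \<subseteq> \<A> \<and> topspace (ends_space G) \<subseteq> (\<Union>A\<in>I. stone_set A)"
    by (intro finite_stone_subcover)
  then obtain I where I: "finite I" "I \<subseteq> \<A>" "topspace (ends_space G) \<subseteq> (\<Union>A\<in>I. stone_set A)"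
    by (elim exE conjE)
  have "\<exists>W\<in>\<U>. stone_set A \<subseteq> W" if "A \<in> I" for A using that I(2) unfolding \<A>_def by blast
  then obtain W where W: "\<And>A. A \<in> I \<Longrightarrow> W A \<in> \<U> \<and> stone_set A \<subseteq> W A" by metis
  show "\<exists>\<F>. finite \<F> \<and> \<F> \<subseteq> \<U> \<and> topspace (ends_space G) \<subseteq> \<Union>\<F>"
  proof (intro exI conjI)
    show "finite (W ` I)" using I(1) by simp
    show "W ` I \<subseteq> \<U>" using W by auto
    have "(\<Union>A\<in>I. stone_set A) \<subseteq> \<Union>(W ` I)" by (rule UN_mono) (use W in auto)
    with I(3) show "topspace (ends_space G) \<subseteq> \<Union>(W ` I)" by (rule subset_trans)
  qed
qed

section \<open>Cellular families in the space of ends\<close>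

lemma cellular_family_ordLeq:
  assumes G: "uncountable (carrier G)" and \<F>: "cellular_family (ends_space G) \<F>"
  shows "|\<F>| \<le>o |carrier G|"
proof -
  have "\<exists>A. A \<in> commensurated G \<and> stone_set A \<noteq> {} \<and> stone_set A \<subseteq> W" if "W \<in> \<F>" for W
  proof -
    have W: "openin (ends_space G) W" "W \<noteq> {}" using \<F> that by (auto simp: cellular_family_def)
    then obtain U where "U \<in> W" by blast
    then show ?thesis using stone_set_base[OF W(1)] by blast
  qed
  then obtain A where A: "\<And>W. W \<in> \<F> \<Longrightarrow> A W \<in> commensurated G"
    "\<And>W. W \<in> \<F> \<Longrightarrow> stone_set (A W) \<noteq> {}" "\<And>W. W \<in> \<F> \<Longrightarrow> stone_set (A W) \<subseteq> W"
    by metis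
  show ?thesis
  proof (rule almost_disjoint_family_ordLeq[OF G A(1)])
    show "infinite (A W)" if "W \<in> \<F>" for W
      using A(1,2)[OF that] by (simp add: stone_set_nonempty_iff)
    fix V W assume VW: "V \<in> \<F>" "W \<in> \<F>" "V \<noteq> W"
    then have "V \<inter> W = {}" using \<F> by (auto simp: cellular_family_def pairwise_def disjnt_def)
    then have "stone_set (A V \<inter> A W) = {}"
      using A(3)[OF VW(1)] A(3)[OF VW(2)] stone_set_Int[OF A(1)[OF VW(1)] A(1)[OF VW(2)]] by blast
    then show "finite (A V \<inter> A W)"
      using stone_set_nonempty_iff[OF Int_commensurated[OF A(1)[OF VW(1)] A(1)[OF VW(2)]]] by blast
  qed
qed

lemma infinitely_ended_imp_splitting:
  assumes "infinitely_ended G"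
  obtains A where "A \<in> commensurated G" "infinite A" "infinite (carrier G - A)"
proof (rule ccontr)
  assume no: "\<not> thesis"
  have "carrier (ends_algebra G) \<subseteq> {ends_class {}, ends_class (carrier G)}"
  proof
    fix x assume "x \<in> carrier (ends_algebra G)"
    then obtain A where A: "A \<in> commensurated G" "x = ends_class A" by (rule ends_class_cases)
    have "finite A \<or> finite (carrier G - A)" using no that[OF A(1)] by blast
    moreover have "sym_diff A (carrier G) = carrier G - A" using commensuratedD(1)[OF A(1)] by blast
    ultimately have "x = ends_class {} \<or> x = ends_class (carrier G)"
      unfolding A(2) ends_class_eq_iff[OF A(1) empty_commensurated]
        ends_class_eq_iff[OF A(1) carrier_commensurated] by simp
    then show "x \<in> {ends_class {}, ends_class (carrier G)}" by blast
  qed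
  then have "finite (carrier (ends_algebra G))" by (rule finite_subset) simp
  with assms show False by (simp add: infinitely_ended_def)
qed

lemma large_cellular_family:
  assumes G: "infinitely_ended G" and Z: "infinite Z" "|Z| <o |carrier G|"
  obtains \<F> where "cellular_family (ends_space G) \<F>" "|Z| <o |\<F>|"
proof -
  obtain A where A: "A \<in> commensurated G" "infinite A" "infinite (carrier G - A)"
    using G by (rule infinitely_ended_imp_splitting)
  obtain \<N> where \<N>: "\<N> \<subseteq> commensurated G" "\<And>N. N \<in> \<N> \<Longrightarrow> infinite N" "pairwise disjnt \<N>"
    and card: "|Z| <o |\<N>|"
    by (rule large_disjoint_family[OF A Z]) blast
  have ne: "stone_set N \<noteq> {}" if "N \<in> \<N>" for N
    using that \<N>(1,2) stone_set_nonempty_iff by blast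
  have dis: "stone_set M \<inter> stone_set N = {}" if MN: "M \<in> \<N>" "N \<in> \<N>" "M \<noteq> N" for M N
  proof -
    have "M \<in> commensurated G" "N \<in> commensurated G" using MN \<N>(1) by auto
    moreover have "M \<inter> N = {}" using \<N>(3) MN by (auto simp: pairwise_def disjnt_def)
    ultimately show ?thesis
      using stone_set_Int[of M N] stone_set_nonempty_iff[OF empty_commensurated] by simp
  qed
  have "inj_on stone_set \<N>"
  proof (rule inj_onI, rule ccontr)
    fix M N assume "M \<in> \<N>" "N \<in> \<N>" "stone_set M = stone_set N" "M \<noteq> N"
    then show False using dis[of M N] ne[of M] by simp
  qed
  then have "|\<N>| \<le>o |stone_set ` \<N>|" by (meson card_of_ordLeq order_refl)
  with card have "|Z| <o |stone_set ` \<N>|" by (rule ordLess_ordLeq_trans)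
  moreover have "cellular_family (ends_space G) (stone_set ` \<N>)"
    unfolding cellular_family_def
  proof (intro conjI ballI)
    show "openin (ends_space G) W" "W \<noteq> {}" if "W \<in> stone_set ` \<N>" for W
      using that ne \<N>(1) openin_stone_set by auto
    show "pairwise disjnt (stone_set ` \<N>)"
      using dis by (fastforce simp: pairwise_def disjnt_def)
  qed
  ultimately show ?thesis by (rule that[rotated])
qed

end

section \<open>Separability, metrizability and cellular families\<close>

lemma compact_metrizable_imp_separable:
  assumes "compact_space X" "metrizable_space X"
  shows "separable_space X"
proof -
  obtain M d where Md: "Metric_space M d" and X: "X = Metric_space.mtopology M d"
    using assms(2) by (auto simp: metrizable_space_def)
  interpret Metric_space M d by (rule Md)
  have "mtotally_bounded M"
    using assms(1) by (simp add: X compact_space_def compactin_imp_mtotally_bounded)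
  then have "\<exists>K. finite K \<and> K \<subseteq> M \<and> M \<subseteq> (\<Union>x\<in>K. mball x (inverse (Suc n)))" for n :: nat
    by (simp add: mtotally_bounded_def)
  then obtain K where K: "\<And>n::nat. finite (K n) \<and> K n \<subseteq> M \<and> M \<subseteq> (\<Union>x\<in>K n. mball x (inverse (Suc n)))"
    by metis
  let ?C = "\<Union>n. K n"
  have "x \<in> mtopology closure_of ?C" if x: "x \<in> M" for x
    unfolding metric_closure_of
  proof (intro CollectI conjI allI impI x)
    fix r :: real assume "0 < r"
    then obtain n where n: "inverse (real (Suc n)) < r" using reals_Archimedean by blast
    obtain y where y: "y \<in> K n" "x \<in> mball y (inverse (Suc n))" using K[of n] x by blast
    then have "d x y < r" using n by (simp add: commute)
    then show "\<exists>y\<in>?C. y \<in> mball x r" using y x K[of n] by auto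
  qed
  then have "mtopology closure_of ?C = M"
    using closure_of_subset_topspace[of mtopology] by auto
  moreover have "countable ?C" using K by (simp add: countable_finite)
  ultimately show ?thesis
    unfolding separable_space_def X topspace_mtopology using K by blast
qed

lemma separable_imp_countable_cellular_family:
  assumes X: "separable_space X" and \<F>: "cellular_family X \<F>"
  shows "countable \<F>"
proof -
  obtain C where C: "countable C" "C \<subseteq> topspace X" "X closure_of C = topspace X"
    using X unfolding separable_space_def by blast
  have "\<exists>c\<in>C. c \<in> W" if W: "W \<in> \<F>" for W
  proof -
    have *: "openin X W" "W \<noteq> {}" using \<F> W by (auto simp: cellular_family_def)
    then obtain x where x: "x \<in> W" by blast
    then have "x \<in> X closure_of C" using C(3) openin_subset[OF *(1)] by blast
    then show ?thesis using *(1) x by (auto simp: in_closure_of)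
  qed
  then obtain c where c: "\<And>W. W \<in> \<F> \<Longrightarrow> c W \<in> C \<and> c W \<in> W" by metis
  have "inj_on c \<F>"
  proof (rule inj_onI, rule ccontr)
    fix V W assume VW: "V \<in> \<F>" "W \<in> \<F>" "c V = c W" "V \<noteq> W"
    then have "disjnt V W" using \<F> by (auto simp: cellular_family_def pairwise_def)
    moreover have "c V \<in> V" "c V \<in> W" using c[OF VW(1)] c[OF VW(2)] VW(3) by auto
    ultimately show False by (auto simp: disjnt_def)
  qed
  moreover have "countable (c ` \<F>)" by (rule countable_subset[OF _ C(1)]) (use c in auto)
  ultimately show ?thesis by (rule countable_image_inj_on[rotated])
qed

section \<open>The cellularity of the space of ends\<close>

theorem theorem1p16:
  fixes G :: "('a, 'b) monoid_scheme" (structure)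
  assumes "group G"
    and "infinitely_ended G"
    and "uncountable (carrier G)"
  shows "has_cellularity (ends_space G) |carrier G| \<and>
         \<not> separable_space (ends_space G) \<and>
         \<not> metrizable_space (ends_space G)"
proof -
  interpret group G by (rule assms(1))
  have inf: "infinite (carrier G)" using assms(3) by (rule uncountable_infinite)
  obtain C where C: "C \<subseteq> carrier G" "countable C" "infinite C"
    using infinite_countable_subset'[OF inf] by blast
  have C_less: "|C| <o |carrier G|"
  proof -
    have "\<not> |carrier G| \<le>o |C|"
    proof
      assume "|carrier G| \<le>o |C|"
      then obtain f where f: "inj_on f (carrier G)" "f ` carrier G \<subseteq> C"
        using card_of_ordLeq[of "carrier G" C] by blast
      have "countable (f ` carrier G)" by (rule countable_subset[OF f(2) C(2)])
      then show False using countable_image_inj_on[OF _ f(1)] assms(3) by blast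
    qed
    then show ?thesis by (simp add: not_ordLeq_iff_ordLess)
  qed
  have lub: "|carrier G| \<le>o \<kappa>'"
    if "Card_order \<kappa>'" and ub: "\<forall>\<F>. cellular_family (ends_space G) \<F> \<longrightarrow> |\<F>| \<le>o \<kappa>'"
    for \<kappa>' :: "'a rel"
  proof (rule ccontr)
    assume "\<not> |carrier G| \<le>o \<kappa>'"
    have Field: "|Field \<kappa>'| =o \<kappa>'" by (rule card_of_Field_ordIso[OF \<open>Card_order \<kappa>'\<close>])
    \<comment> \<open>a representative of \<open>\<kappa>'\<close>, enlarged to be infinite if necessary\<close>
    define Z where "Z = (if finite (Field \<kappa>') then C else Field \<kappa>')"
    have "infinite Z" using C(3) by (simp add: Z_def)
    have W: "Well_order \<kappa>'" using \<open>Card_order \<kappa>'\<close> by (simp only: card_order_on_def)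
    have "\<kappa>' <o |carrier G|"
      by (rule not_ordLeq_iff_ordLess[OF W card_of_Well_order, THEN iffD1])
        (rule \<open>\<not> |carrier G| \<le>o \<kappa>'\<close>)
    then have "|Field \<kappa>'| <o |carrier G|" by (rule ordIso_ordLess_trans[OF Field])
    then have Z_less: "|Z| <o |carrier G|" using C_less by (simp add: Z_def)
    have "|Field \<kappa>'| \<le>o |Z|"
      using C(3) by (simp add: Z_def finite_ordLess_infinite2 ordLess_imp_ordLeq)
    then have "\<kappa>' \<le>o |Z|" by (rule ordIso_ordLeq_trans[OF ordIso_symmetric[OF Field]])
    obtain \<F> where \<F>: "cellular_family (ends_space G) \<F>" "|Z| <o |\<F>|"
      by (rule large_cellular_family[OF assms(2) \<open>infinite Z\<close> Z_less])
    have "|\<F>| \<le>o |Z|" by (rule ordLeq_transitive[OF ub[rule_format, OF \<F>(1)] \<open>\<kappa>' \<le>o |Z|\<close>])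
    with \<F>(2) show False by (simp add: not_ordLess_ordLeq)
  qed
  have "\<not> separable_space (ends_space G)"
  proof
    assume sep: "separable_space (ends_space G)"
    obtain \<F> where \<F>: "cellular_family (ends_space G) \<F>" "|C| <o |\<F>|"
      by (rule large_cellular_family[OF assms(2) C(3) C_less])
    have "|\<F>| \<le>o |C|"
      by (rule countable_ordLeq_infinite[OF separable_imp_countable_cellular_family[OF sep \<F>(1)] C(3)])
    with \<F>(2) show False by (simp add: not_ordLess_ordLeq)
  qed
  moreover have "\<not> metrizable_space (ends_space G)"
    using compact_metrizable_imp_separable[OF compact_ends_space] calculation by blast
  moreover have "has_cellularity (ends_space G) |carrier G|"
    using cellular_family_ordLeq[OF assms(3)] lub card_of_Card_order
    unfolding has_cellularity_def by blast
  ultimately show ?thesis by blast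
qed

end
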